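(* Let $(X,\xi)$ be a homotopy semigroup in $(\mathbf{Top}_*,\times,1)$. Then $(X,\xi)$ gives rise to an $A_4$-space whose underlying based space is $X(1)$.
   Context: $\mathbf{Top}_*$ is the category of based spaces and basepoint-preserving maps, with cartesian product $\times$, one-point space $1$, and based homotopy equivalences as equivalences. $\Delta_{\mathrm{surj}}$ is the category with objects $n=\{0,\dots,n-1\}$ ($n\ge0$) and surjective order-preserving maps, monoidal under ordinal sum $+$ with unit $0$. A homotopy semigroup in $\mathbf{Top}_*$ is a colax monoidal functor $(X,\xi):(\Delta_{\mathrm{surj}},+,0)\to(\mathbf{Top}_*,\times,1)$ — a functor $X$ with based maps $\xi_{m,n}:X(m+n)\to X(m)\times X(n)$ natural in $m,n$ and $\xi_0:X(0)\to1$ satisfying the coassociativity and counit axioms (not required to be invertible) — such that $\xi_0$ and all $\xi_{m,n}$ are based homotopy equivalences. An $A_4$-space (in the sense of Stasheff) on a based space $(A,a_0)$ consists of: a map $m_2:A\times A\to A$ with $m_2(a_0,a_0)=a_0$; a basepoint-respecting homotopy $m_3:K_3\times A^3\to A$ ($K_3=[0,1]$) between $m_2\circ(m_2\times1)$ and $m_2\circ(1\times m_2)$; and a map $m_4:K_4\times A^4\to A$, $K_4$ the solid pentagon (Stasheff's associahedron), whose restriction to the boundary of $K_4$ is the loop of maps $A^4\to A$ through the five bracketings of a fourfold product given by the appropriate instances of $m_2$ and $m_3$ (i.e. a homotopy between the two composite homotopies built from $m_3$ relating $((ab)c)d$ and $a(b(cd))$). *)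

theory Defs
  imports "HOL-Analysis.Analysis" "HOL-Library.FuncSet"
begin

definition based_map :: "'a topology \<Rightarrow> 'a \<Rightarrow> 'b topology \<Rightarrow> 'b \<Rightarrow> ('a \<Rightarrow> 'b) \<Rightarrow> bool" where
  "based_map A a0 B b0 f \<longleftrightarrow> continuous_map A B f \<and> f a0 = b0"

definition based_homotopic :: "'a topology \<Rightarrow> 'a \<Rightarrow> 'b topology \<Rightarrow> 'b \<Rightarrow> ('a \<Rightarrow> 'b) \<Rightarrow> ('a \<Rightarrow> 'b) \<Rightarrow> bool" where
  "based_homotopic A a0 B b0 f g \<longleftrightarrow> homotopic_with (\<lambda>k. k a0 = b0) A B f g"

definition based_homotopy_inverse ::
  "'a topology \<Rightarrow> 'a \<Rightarrow> 'b topology \<Rightarrow> 'b \<Rightarrow> ('a \<Rightarrow> 'b) \<Rightarrow> ('b \<Rightarrow> 'a) \<Rightarrow> bool" where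
  "based_homotopy_inverse A a0 B b0 f g \<longleftrightarrow>
     based_map B b0 A a0 g \<and>
     based_homotopic A a0 A a0 (g \<circ> f) id \<and>
     based_homotopic B b0 B b0 (f \<circ> g) id"

definition based_heq :: "'a topology \<Rightarrow> 'a \<Rightarrow> 'b topology \<Rightarrow> 'b \<Rightarrow> ('a \<Rightarrow> 'b) \<Rightarrow> bool" where
  "based_heq A a0 B b0 f \<longleftrightarrow> based_map A a0 B b0 f \<and> (\<exists>g. based_homotopy_inverse A a0 B b0 f g)"

definition one_space :: "unit topology" where
  "one_space = discrete_topology {()}"

definition surj_mor :: "nat \<Rightarrow> nat \<Rightarrow> (nat \<Rightarrow> nat) set" where
  "surj_mor n m = {f. f \<in> {0..<n} \<rightarrow>\<^sub>E {0..<m} \<and> mono_on {0..<n} f \<and> f ` {0..<n} = {0..<m}}"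

definition id_mor :: "nat \<Rightarrow> nat \<Rightarrow> nat" where
  "id_mor n = restrict id {0..<n}"

definition comp_mor :: "nat \<Rightarrow> (nat \<Rightarrow> nat) \<Rightarrow> (nat \<Rightarrow> nat) \<Rightarrow> nat \<Rightarrow> nat" where
  "comp_mor n g f = compose {0..<n} g f"

definition osum_mor :: "nat \<Rightarrow> nat \<Rightarrow> nat \<Rightarrow> (nat \<Rightarrow> nat) \<Rightarrow> (nat \<Rightarrow> nat) \<Rightarrow> nat \<Rightarrow> nat" where
  "osum_mor m n m' f g = restrict (\<lambda>i. if i < m then f i else m' + g (i - m)) {0..<m+n}"

text \<open>A functor X : Delta_surj -> Top_*: based spaces (X n, b n) and action Xm n m f on
  morphisms f : n -> m.  The colax structure consists of xi m n : X(m+n) -> X(m) x X(n);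
  xi_0 : X(0) -> 1 is the unique map, so the counit axioms reduce to the projections.\<close>
definition homotopy_semigroup ::
  "(nat \<Rightarrow> 'a topology) \<Rightarrow> (nat \<Rightarrow> 'a) \<Rightarrow> (nat \<Rightarrow> nat \<Rightarrow> (nat \<Rightarrow> nat) \<Rightarrow> 'a \<Rightarrow> 'a)
    \<Rightarrow> (nat \<Rightarrow> nat \<Rightarrow> 'a \<Rightarrow> 'a \<times> 'a) \<Rightarrow> bool" where
  "homotopy_semigroup X b Xm \<xi> \<longleftrightarrow>
     \<comment> \<open>based spaces\<close>
     (\<forall>n. b n \<in> topspace (X n)) \<and>
     \<comment> \<open>functor\<close>
     (\<forall>n m f. f \<in> surj_mor n m \<longrightarrow> based_map (X n) (b n) (X m) (b m) (Xm n m f)) \<and>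
     (\<forall>n. \<forall>x\<in>topspace (X n). Xm n n (id_mor n) x = x) \<and>
     (\<forall>n m k f g. f \<in> surj_mor n m \<longrightarrow> g \<in> surj_mor m k \<longrightarrow>
        (\<forall>x\<in>topspace (X n). Xm n k (comp_mor n g f) x = Xm m k g (Xm n m f x))) \<and>
     \<comment> \<open>structure maps are based maps\<close>
     (\<forall>m n. based_map (X (m+n)) (b (m+n)) (prod_topology (X m) (X n)) (b m, b n) (\<xi> m n)) \<and>
     \<comment> \<open>naturality\<close>
     (\<forall>m n m' n' f g. f \<in> surj_mor m m' \<longrightarrow> g \<in> surj_mor n n' \<longrightarrow>
        (\<forall>x\<in>topspace (X (m+n)).
           \<xi> m' n' (Xm (m+n) (m'+n') (osum_mor m n m' f g) x)
             = (Xm m m' f (fst (\<xi> m n x)), Xm n n' g (snd (\<xi> m n x))))) \<and>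
     \<comment> \<open>coassociativity\<close>
     (\<forall>l m n. \<forall>x\<in>topspace (X (l+m+n)).
        (fst (\<xi> l m (fst (\<xi> (l+m) n x))), snd (\<xi> l m (fst (\<xi> (l+m) n x))), snd (\<xi> (l+m) n x))
        = (fst (\<xi> l (m+n) x), fst (\<xi> m n (snd (\<xi> l (m+n) x))), snd (\<xi> m n (snd (\<xi> l (m+n) x))))) \<and>
     \<comment> \<open>counit axioms\<close>
     (\<forall>n. \<forall>x\<in>topspace (X n). snd (\<xi> 0 n x) = x \<and> fst (\<xi> n 0 x) = x) \<and>
     \<comment> \<open>homotopy-equivalence conditions\<close>
     based_heq (X 0) (b 0) one_space () (\<lambda>_. ()) \<and>
     (\<forall>m n. based_heq (X (m+n)) (b (m+n)) (prod_topology (X m) (X n)) (b m, b n) (\<xi> m n))"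

definition K3 :: "real topology" where
  "K3 = top_of_set {0..1}"

text \<open>Pentagon vertices, in cyclic order, labelled by the bracketings
  P0 = ((ab)c)d, P1 = (a(bc))d, P2 = a((bc)d), P3 = a(b(cd)), P4 = (ab)(cd).\<close>
definition P0 :: "real \<times> real" where "P0 = (0, 0)"
definition P1 :: "real \<times> real" where "P1 = (2, 0)"
definition P2 :: "real \<times> real" where "P2 = (3, 1)"
definition P3 :: "real \<times> real" where "P3 = (1, 2)"
definition P4 :: "real \<times> real" where "P4 = (-1, 1)"

definition K4set :: "(real \<times> real) set" where
  "K4set = convex hull {P0, P1, P2, P3, P4}"

definition K4 :: "(real \<times> real) topology" where
  "K4 = top_of_set K4set"

definition seg :: "real \<times> real \<Rightarrow> real \<times> real \<Rightarrow> real \<Rightarrow> real \<times> real" where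
  "seg p q t = (1 - t) *\<^sub>R p + t *\<^sub>R q"

definition A4_space ::
  "'a topology \<Rightarrow> 'a \<Rightarrow> ('a \<times> 'a \<Rightarrow> 'a) \<Rightarrow> (real \<times> 'a \<times> 'a \<times> 'a \<Rightarrow> 'a)
    \<Rightarrow> ((real \<times> real) \<times> 'a \<times> 'a \<times> 'a \<times> 'a \<Rightarrow> 'a) \<Rightarrow> bool" where
  "A4_space A a0 m2 m3 m4 \<longleftrightarrow>
     a0 \<in> topspace A \<and>
     continuous_map (prod_topology A A) A m2 \<and> m2 (a0, a0) = a0 \<and>
     continuous_map (prod_topology K3 (prod_topology A (prod_topology A A))) A m3 \<and>
     (\<forall>a\<in>topspace A. \<forall>b\<in>topspace A. \<forall>c\<in>topspace A.
        m3 (0, a, b, c) = m2 (m2 (a, b), c) \<and> m3 (1, a, b, c) = m2 (a, m2 (b, c))) \<and>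
     (\<forall>t\<in>{0..1}. m3 (t, a0, a0, a0) = a0) \<and>
     continuous_map (prod_topology K4 (prod_topology A (prod_topology A (prod_topology A A)))) A m4 \<and>
     (\<forall>t\<in>{0..1}. \<forall>a\<in>topspace A. \<forall>b\<in>topspace A. \<forall>c\<in>topspace A. \<forall>d\<in>topspace A.
        m4 (seg P0 P1 t, a, b, c, d) = m2 (m3 (t, a, b, c), d) \<and>
        m4 (seg P1 P2 t, a, b, c, d) = m3 (t, a, m2 (b, c), d) \<and>
        m4 (seg P2 P3 t, a, b, c, d) = m2 (a, m3 (t, b, c, d)) \<and>
        m4 (seg P0 P4 t, a, b, c, d) = m3 (t, m2 (a, b), c, d) \<and>
        m4 (seg P4 P3 t, a, b, c, d) = m3 (t, a, b, m2 (c, d)))"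

end

theory Submission
  imports Defs
begin

text \<open>
  Write \<open>A = X 1\<close>, let \<open>g\<close> be a homotopy inverse of \<open>\<xi> 1 1\<close> and \<open>m2 = mu \<circ> g\<close>, where \<open>mu\<close> is induced by
  the map from 2 to 1.  The homotopy from \<open>g \<circ> \<xi> 1 1\<close> to the identity gives a homotopy \<open>eta\<close> from
  \<open>m2 \<circ> \<xi> 1 1\<close> to \<open>mu\<close>.  By naturality and coassociativity, instances of \<open>eta\<close> connect both bracketings of a
  threefold product, pulled back to \<open>X 3\<close>, with the map induced by the surjection from 3 to 1; this yields
  an associativity homotopy over \<open>X 3\<close>, which descends to \<open>m3\<close> because \<open>X 3\<close> is homotopy equivalent to \<open>A\<^sup>3\<close>.
  Pulled back to \<open>X 4\<close>, all five vertices of the pentagon are likewise connected with the map induced by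
  the surjection from 4 to 1, and every edge commutes with these connections, by naturality of homotopies.
  So the pentagon commutes over \<open>X 4\<close>, hence also over \<open>A\<^sup>4\<close>, and the resulting homotopy of
  homotopies is spread over \<open>K4\<close>.
\<close>

subsection \<open>Homotopies as tracks, up to homotopy relative to the ends\<close>

text \<open>Homotopies are treated as morphisms of a groupoid: they are concatenated, reversed and
  cancelled up to homotopy relative to the ends. One obstacle is that the two homotopies of an
  equivalence come without any compatibility between them; transport along an equivalence therefore
  rests on naturality and cancellation alone. Apart from its ends, the only fact about
  \<open>m3\<close> that enters the pentagon is the relation over X 3 from which it is built. Base
  points matter for \<open>m2\<close> and \<open>m3\<close> but not for the filling
  \<open>m4\<close>, so homotopies between homotopies are left free, and only the explicit formula
  behind \<open>m3\<close> is examined at the base point. A second obstacle is the passage from a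
  square to \<open>K4\<close>: the spaces are arbitrary, and the product of a quotient map with an
  arbitrary space need not be a quotient map. Here it is one because the map of the compact square
  onto \<open>K4\<close> is proper.\<close>

abbreviation unit_interval :: "real topology" where
  "unit_interval \<equiv> top_of_set {0..1}"

lemma continuous_map_into_unit_interval:
  assumes "continuous_map Z euclideanreal f" "\<And>z. z \<in> topspace Z \<Longrightarrow> f z \<in> {0..1}"
  shows "continuous_map Z unit_interval f"
  using assms by (auto simp: continuous_map_in_subtopology)

lemma continuous_map_apply:
  assumes "continuous_map X Y f" "continuous_map Z X h"
  shows "continuous_map Z Y (\<lambda>z. f (h z))"
  using continuous_map_compose[OF assms(2,1)] by (simp add: o_def)

lemma continuous_map_fst_apply:
  "continuous_map Z (prod_topology X Y) f \<Longrightarrow> continuous_map Z X (\<lambda>z. fst (f z))"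
  using continuous_map_fst_of by (fastforce simp: o_def)

lemma continuous_map_snd_apply:
  "continuous_map Z (prod_topology X Y) f \<Longrightarrow> continuous_map Z Y (\<lambda>z. snd (f z))"
  using continuous_map_snd_of by (fastforce simp: o_def)

lemma continuous_map_unit_interval_real:
  "continuous_map Z unit_interval f \<Longrightarrow> continuous_map Z euclideanreal f"
  by (simp add: continuous_map_in_subtopology)

lemmas cont_rules = continuous_map_id[unfolded id_def] continuous_map_pairedI
  continuous_map_fst_apply continuous_map_snd_apply

text \<open>\<open>homotopic_with\<close> only asserts that a homotopy exists; here homotopies are
  themselves concatenated and compared, so they are kept as explicit functions.\<close>

definition track ::
  "'a topology \<Rightarrow> 'b topology \<Rightarrow> ('a \<Rightarrow> 'b) \<Rightarrow> ('a \<Rightarrow> 'b) \<Rightarrow> (real \<times> 'a \<Rightarrow> 'b) \<Rightarrow> bool" where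
  "track S T u v p \<longleftrightarrow> continuous_map (prod_topology unit_interval S) T p \<and>
     (\<forall>x\<in>topspace S. p (0, x) = u x \<and> p (1, x) = v x)"

text \<open>The predicate given to \<open>homotopic_with\<close> constrains every stage of the
  deformation, which makes this homotopy relative to both ends.\<close>

definition track_eq ::
  "'a topology \<Rightarrow> 'b topology \<Rightarrow> ('a \<Rightarrow> 'b) \<Rightarrow> ('a \<Rightarrow> 'b)
    \<Rightarrow> (real \<times> 'a \<Rightarrow> 'b) \<Rightarrow> (real \<times> 'a \<Rightarrow> 'b) \<Rightarrow> bool" where
  "track_eq S T u v =
     homotopic_with (\<lambda>k. \<forall>x\<in>topspace S. k (0, x) = u x \<and> k (1, x) = v x)
       (prod_topology unit_interval S) T"

definition join_track :: "(real \<times> 'a \<Rightarrow> 'b) \<Rightarrow> (real \<times> 'a \<Rightarrow> 'b) \<Rightarrow> real \<times> 'a \<Rightarrow> 'b" where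
  "join_track p q z = (if fst z \<le> 1/2 then p (2 * fst z, snd z) else q (2 * fst z - 1, snd z))"

definition rev_track :: "(real \<times> 'a \<Rightarrow> 'b) \<Rightarrow> real \<times> 'a \<Rightarrow> 'b" where
  "rev_track p z = p (1 - fst z, snd z)"

lemma trackD:
  assumes "track S T u v p"
  shows "continuous_map (prod_topology unit_interval S) T p"
    and "x \<in> topspace S \<Longrightarrow> p (0, x) = u x" and "x \<in> topspace S \<Longrightarrow> p (1, x) = v x"
  using assms by (auto simp: track_def)

lemma track_eq_iff:
  "track_eq S T u v p q \<longleftrightarrow> (\<exists>F. continuous_map (prod_topology unit_interval (prod_topology unit_interval S)) T F \<and>
     (\<forall>t\<in>{0..1}. \<forall>x\<in>topspace S. F (0, t, x) = p (t, x) \<and> F (1, t, x) = q (t, x) \<and>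
        F (t, 0, x) = u x \<and> F (t, 1, x) = v x))"
  unfolding track_eq_def
  apply (subst homotopic_with)
   apply simp
  apply (rule ex_cong1)
  apply auto
  done

lemma track_eq_refl: "track_eq S T u v p p \<longleftrightarrow> track S T u v p"
  by (simp add: track_eq_def track_def)

lemma track_eq_sym: "track_eq S T u v p q \<Longrightarrow> track_eq S T u v q p"
  unfolding track_eq_def by (rule homotopic_with_symD)

lemma track_eq_trans [trans]: "track_eq S T u v p q \<Longrightarrow> track_eq S T u v q r \<Longrightarrow> track_eq S T u v p r"
  unfolding track_eq_def by (rule homotopic_with_trans)

lemma track_eq_cong:
  assumes "track_eq S T u v p q"
    and "\<And>t x. t \<in> {0..1} \<Longrightarrow> x \<in> topspace S \<Longrightarrow> p' (t, x) = p (t, x)"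
    and "\<And>t x. t \<in> {0..1} \<Longrightarrow> x \<in> topspace S \<Longrightarrow> q' (t, x) = q (t, x)"
    and "\<And>x. x \<in> topspace S \<Longrightarrow> u' x = u x" "\<And>x. x \<in> topspace S \<Longrightarrow> v' x = v x"
  shows "track_eq S T u' v' p' q'"
proof -
  obtain F where F: "continuous_map (prod_topology unit_interval (prod_topology unit_interval S)) T F"
    "\<forall>t\<in>{0..1}. \<forall>x\<in>topspace S. F (0, t, x) = p (t, x) \<and> F (1, t, x) = q (t, x) \<and>
        F (t, 0, x) = u x \<and> F (t, 1, x) = v x"
    using assms(1) unfolding track_eq_iff by blast
  show ?thesis
    unfolding track_eq_iff using F assms(2-) by (intro exI[of _ F]) simp
qed

text \<open>The second argument of \<open>F\<close> remembers the point of \<open>S'\<close>. Thus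
  one lemma covers precomposition, postcomposition, and multiplication of a track by another
  coordinate of the same point.\<close>

lemma track_eq_whisker:
  assumes pq: "track_eq S T u v p q"
    and k: "continuous_map S' S k" and F: "continuous_map (prod_topology T S') T' F"
  shows "track_eq S' T' (\<lambda>x. F (u (k x), x)) (\<lambda>x. F (v (k x), x))
           (\<lambda>z. F (p (fst z, k (snd z)), snd z)) (\<lambda>z. F (q (fst z, k (snd z)), snd z))"
proof -
  obtain G where G: "continuous_map (prod_topology unit_interval (prod_topology unit_interval S)) T G"
    "\<forall>t\<in>{0..1}. \<forall>x\<in>topspace S. G (0, t, x) = p (t, x) \<and> G (1, t, x) = q (t, x) \<and>
        G (t, 0, x) = u x \<and> G (t, 1, x) = v x"
    using pq unfolding track_eq_iff by blast
  have kx: "k x \<in> topspace S" if "x \<in> topspace S'" for x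
    using k that by (auto simp: continuous_map_def)
  have "continuous_map (prod_topology unit_interval (prod_topology unit_interval S')) T'
          (\<lambda>z. F (G (fst z, fst (snd z), k (snd (snd z))), snd (snd z)))"
    by (rule continuous_map_apply[OF F] continuous_map_apply[OF G(1)] continuous_map_apply[OF k] cont_rules)+
  then show ?thesis
    unfolding track_eq_iff using G(2) kx
    by (intro exI[of _ "\<lambda>z. F (G (fst z, fst (snd z), k (snd (snd z))), snd (snd z))"]) auto
qed

lemma track_eq_precompose:
  assumes "track_eq S T u v p q" "continuous_map S' S k"
  shows "track_eq S' T (\<lambda>x. u (k x)) (\<lambda>x. v (k x)) (\<lambda>z. p (fst z, k (snd z))) (\<lambda>z. q (fst z, k (snd z)))"
  using track_eq_whisker[OF assms, of T fst] by (simp add: continuous_map_fst)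

lemma track_eq_postcompose:
  assumes "track_eq S T u v p q" "continuous_map T T' F"
  shows "track_eq S T' (\<lambda>x. F (u x)) (\<lambda>x. F (v x)) (\<lambda>z. F (p z)) (\<lambda>z. F (q z))"
  using track_eq_whisker[OF assms(1) continuous_map_id, of T' "F \<circ> fst"] assms(2)
  by (simp add: continuous_map_compose[OF continuous_map_fst])

lemma track_precompose:
  "track S T u v p \<Longrightarrow> continuous_map S' S k \<Longrightarrow>
     track S' T (\<lambda>x. u (k x)) (\<lambda>x. v (k x)) (\<lambda>z. p (fst z, k (snd z)))"
  using track_eq_precompose[of S T u v p p] by (simp add: track_eq_refl)

lemma track_postcompose:
  "track S T u v p \<Longrightarrow> continuous_map T T' F \<Longrightarrow> track S T' (\<lambda>x. F (u x)) (\<lambda>x. F (v x)) (\<lambda>z. F (p z))"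
  using track_eq_postcompose[of S T u v p p] by (simp add: track_eq_refl)

text \<open>All groupoid laws and all coherence squares below are instances of this lemma: two paths
  with the same ends in a convex parameter domain are homotopic by a straight line.\<close>
lemma track_eq_convex:
  fixes W :: "'c::real_normed_vector set"
  assumes F: "continuous_map (prod_topology (top_of_set W) S) T F" and W: "convex W"
    and g: "continuous_on {0..1} g" "g \<in> {0..1} \<rightarrow> W"
    and h: "continuous_on {0..1} h" "h \<in> {0..1} \<rightarrow> W"
    and ends: "g 0 = h 0" "g 1 = h 1"
  shows "track_eq S T (\<lambda>x. F (g 0, x)) (\<lambda>x. F (g 1, x)) (\<lambda>z. F (g (fst z), snd z)) (\<lambda>z. F (h (fst z), snd z))"
proof -
  let ?l = "\<lambda>w. (1 - fst w) *\<^sub>R g (snd w) + fst w *\<^sub>R h (snd w)"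
  have "?l \<in> {0..1} \<times> {0..1} \<rightarrow> W"
    using g(2) h(2) W by (auto simp: Pi_iff intro!: convexD)
  moreover have "continuous_on ({0..1} \<times> {0..1}) ?l"
    by (intro continuous_intros continuous_on_compose2[OF g(1)] continuous_on_compose2[OF h(1)]) auto
  ultimately have l: "continuous_map (prod_topology unit_interval unit_interval) (top_of_set W) ?l"
    by (simp add: prod_topology_subtopology_eu)
  have "continuous_map (prod_topology unit_interval (prod_topology unit_interval S)) T
          (\<lambda>z. F (?l (fst z, fst (snd z)), snd (snd z)))"
    by (rule continuous_map_apply[OF F] continuous_map_pairedI continuous_map_apply[OF l] cont_rules)+
  then show ?thesis
    unfolding track_eq_iff using ends
    by (intro exI[of _ "\<lambda>z. F (?l (fst z, fst (snd z)), snd (snd z))"])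
       (auto simp flip: scaleR_left_distrib)
qed

lemma track_eq_reparam:
  assumes p: "continuous_map (prod_topology unit_interval S) T c"
    and "continuous_on {0..1} g" "g \<in> {0..1} \<rightarrow> {0..1}"
    and "continuous_on {0..1} h" "h \<in> {0..1} \<rightarrow> {0..1}"
    and "g 0 = h 0" "g 1 = h 1"
    and p: "\<And>t x. t \<in> {0..1} \<Longrightarrow> x \<in> topspace S \<Longrightarrow> p (t, x) = c (g t, x)"
    and q: "\<And>t x. t \<in> {0..1} \<Longrightarrow> x \<in> topspace S \<Longrightarrow> q (t, x) = c (h t, x)"
    and u: "\<And>x. x \<in> topspace S \<Longrightarrow> p (0, x) = u x" and v: "\<And>x. x \<in> topspace S \<Longrightarrow> p (1, x) = v x"
  shows "track_eq S T u v p q"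
  by (rule track_eq_cong[OF track_eq_convex[OF assms(1) _ assms(2-7)]]) (use p q u v in \<open>auto simp flip: u v\<close>)

section \<open>Concatenation, reversal and the groupoid laws\<close>

lemma track_join:
  assumes p: "track S T u v p" and q: "track S T v w q"
  shows "track S T u w (join_track p q)"
proof -
  let ?I = "prod_topology unit_interval S"
  have fst: "continuous_map ?I euclideanreal fst"
    by (rule continuous_map_unit_interval_real[OF continuous_map_fst])
  have "continuous_map ?I T (\<lambda>z. if fst z \<le> 1/2 then p (2 * fst z, snd z) else q (2 * fst z - 1, snd z))"
  proof (rule continuous_map_cases_le[OF fst])
    show "continuous_map (subtopology ?I {x \<in> topspace ?I. fst x \<le> 1/2}) T (\<lambda>z. p (2 * fst z, snd z))"
      by (intro continuous_map_apply[OF trackD(1)[OF p]] continuous_map_pairedI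
          continuous_map_into_unit_interval continuous_map_real_mult continuous_map_from_subtopology[OF fst]
          continuous_map_from_subtopology[OF continuous_map_snd]) auto
    show "continuous_map (subtopology ?I {x \<in> topspace ?I. 1/2 \<le> fst x}) T (\<lambda>z. q (2 * fst z - 1, snd z))"
      by (intro continuous_map_apply[OF trackD(1)[OF q]] continuous_map_pairedI
          continuous_map_into_unit_interval continuous_map_diff continuous_map_real_mult continuous_map_from_subtopology[OF fst]
          continuous_map_from_subtopology[OF continuous_map_snd]) auto
    show "p (2 * fst z, snd z) = q (2 * fst z - 1, snd z)" if "z \<in> topspace ?I" "fst z = 1/2" for z
    proof -
      have "2 * fst z = 1" "2 * fst z - 1 = 0" "snd z \<in> topspace S"
        using that by auto
      then show ?thesis
        by (simp only: trackD(3)[OF p] trackD(2)[OF q])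
    qed
  qed auto
  then show ?thesis
    using p q by (auto simp: track_def join_track_def[abs_def])
qed

lemma track_rev:
  assumes p: "track S T u v p"
  shows "track S T v u (rev_track p)"
proof -
  have "continuous_map (prod_topology unit_interval S) T (\<lambda>z. p (1 - fst z, snd z))"
    by (intro continuous_map_apply[OF trackD(1)[OF p]] continuous_map_pairedI
          continuous_map_into_unit_interval continuous_map_diff
          continuous_map_unit_interval_real[OF continuous_map_fst] continuous_map_snd) auto
  then show ?thesis
    using p by (auto simp: track_def rev_track_def[abs_def])
qed

lemma rev_track_rev_track [simp]: "rev_track (rev_track p) = p"
  by (simp add: rev_track_def fun_eq_iff)

lemma track_eq_join:
  assumes p: "track_eq S T u v p p'" and q: "track_eq S T v w q q'"
  shows "track_eq S T u w (join_track p q) (join_track p' q')"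
proof -
  obtain F where F: "continuous_map (prod_topology unit_interval (prod_topology unit_interval S)) T F"
    "\<forall>t\<in>{0..1}. \<forall>x\<in>topspace S. F (0, t, x) = p (t, x) \<and> F (1, t, x) = p' (t, x) \<and>
        F (t, 0, x) = u x \<and> F (t, 1, x) = v x"
    using p unfolding track_eq_iff by blast
  obtain G where G: "continuous_map (prod_topology unit_interval (prod_topology unit_interval S)) T G"
    "\<forall>t\<in>{0..1}. \<forall>x\<in>topspace S. G (0, t, x) = q (t, x) \<and> G (1, t, x) = q' (t, x) \<and>
        G (t, 0, x) = v x \<and> G (t, 1, x) = w x"
    using q unfolding track_eq_iff by blast
  let ?S = "prod_topology unit_interval S"
  \<comment> \<open>swap the two parameters, so that the concatenation runs in the outer one\<close>
  let ?sw = "\<lambda>H z. H (fst (snd z), fst z, snd (snd z))"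
  have sw: "continuous_map (prod_topology unit_interval ?S) T (?sw H)"
    if "continuous_map (prod_topology unit_interval ?S) T H" for H :: "real \<times> real \<times> 'a \<Rightarrow> 'b"
    by (rule continuous_map_apply[OF that] cont_rules)+
  have "track ?S T (\<lambda>z. u (snd z)) (\<lambda>z. v (snd z)) (?sw F)"
    using sw[OF F(1)] F(2) by (auto simp: track_def)
  moreover have "track ?S T (\<lambda>z. v (snd z)) (\<lambda>z. w (snd z)) (?sw G)"
    using sw[OF G(1)] G(2) by (auto simp: track_def)
  ultimately have c: "continuous_map (prod_topology unit_interval ?S) T (join_track (?sw F) (?sw G))"
    using track_join trackD(1) by blast
  show ?thesis
    unfolding track_eq_iff
    by (intro exI[of _ "?sw (join_track (?sw F) (?sw G))"] conjI sw[OF c])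
       (use F(2) G(2) in \<open>auto simp: join_track_def\<close>)
qed

lemma track_eq_join_assoc:
  assumes p: "track S T u v p" and q: "track S T v w q" and r: "track S T w y r"
  shows "track_eq S T u y (join_track (join_track p q) r) (join_track p (join_track q r))"
proof (rule track_eq_reparam[OF trackD(1)[OF track_join[OF p track_join[OF q r]]]])
  \<comment> \<open>Carries the breakpoints 1/4 and 1/2 of the left bracketing to the breakpoints
    1/2 and 3/4 of the right one.\<close>
  let ?g = "\<lambda>t::real. if t \<le> 1/2 then (if t \<le> 1/4 then 2 * t else t + 1/4) else (t + 1)/2"
  have "continuous_on ({0..1/4} \<union> {1/4..1/2}) (\<lambda>t::real. if t \<le> 1/4 then 2 * t else t + 1/4)"
    by (intro continuous_on_cases continuous_intros) auto
  moreover have "{0..1/4} \<union> {1/4..1/2} = {0..1/2::real}"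
    by auto
  ultimately have "continuous_on ({0..1/2} \<union> {1/2..1}) ?g"
    by (intro continuous_on_cases continuous_intros) auto
  moreover have "{0..1/2} \<union> {1/2..1} = {0..1::real}"
    by auto
  ultimately show "continuous_on {0..1} ?g"
    by simp
  show "?g \<in> {0..1} \<rightarrow> {0..1}"
    by auto
  show "join_track (join_track p q) r (t, x) = join_track p (join_track q r) (?g t, x)" if "t \<in> {0..1}" "x \<in> topspace S" for t x
    by (auto simp: join_track_def algebra_simps add_divide_distrib)
qed (use p q r in \<open>auto simp: join_track_def track_def\<close>)

text \<open>Both sides run inside \<open>join_track a p\<close>: one starts at parameter 1/2, goes
  back to 0 and then traverses everything, the other is the second half alone.\<close>

lemma track_eq_cancel_left_rev:
  assumes a: "track S T u v a" and p: "track S T v w p"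
  shows "track_eq S T v w (join_track (rev_track a) (join_track a p)) p"
proof (rule track_eq_reparam[OF trackD(1)[OF track_join[OF a p]]])
  let ?g = "\<lambda>t::real. if t \<le> 1/2 then 1/2 - t else 2 * t - 1"
  have "continuous_on ({0..1/2} \<union> {1/2..1}) ?g"
    by (intro continuous_on_cases continuous_intros) auto
  moreover have "{0..1/2} \<union> {1/2..1} = {0..1::real}"
    by auto
  ultimately show "continuous_on {0..1} ?g"
    by simp
  show "continuous_on {0..1} (\<lambda>t::real. (t + 1)/2)"
    by (intro continuous_intros) auto
  show "join_track (rev_track a) (join_track a p) (t, x) = join_track a p (?g t, x)" if "t \<in> {0..1}" "x \<in> topspace S" for t x
    using that by (auto simp: join_track_def rev_track_def algebra_simps)
  show "p (t, x) = join_track a p ((t + 1)/2, x)" if "t \<in> {0..1}" "x \<in> topspace S" for t x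
    \<comment> \<open>At \<open>t = 0\<close> the parameter 1/2 still falls into the branch of
      \<open>a\<close>, whose end is the start of \<open>p\<close>.\<close>
    using that trackD(2)[OF p] trackD(3)[OF a] by (cases "t = 0") (auto simp: join_track_def add_divide_distrib)
qed (use p a in \<open>auto simp: join_track_def rev_track_def track_def\<close>)

text \<open>Mirror image of the previous law: inside \<open>join_track p a\<close> the parameter
  goes up to 1 and back to 1/2, while \<open>p\<close> is the first half.\<close>

lemma track_eq_cancel_right_rev:
  assumes p: "track S T u v p" and a: "track S T v w a"
  shows "track_eq S T u v (join_track (join_track p a) (rev_track a)) p"
proof (rule track_eq_reparam[OF trackD(1)[OF track_join[OF p a]]])
  let ?g = "\<lambda>t::real. if t \<le> 1/2 then 2 * t else 3/2 - t"
  have "continuous_on ({0..1/2} \<union> {1/2..1}) ?g"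
    by (intro continuous_on_cases continuous_intros) auto
  moreover have "{0..1/2} \<union> {1/2..1} = {0..1::real}"
    by auto
  ultimately show "continuous_on {0..1} ?g"
    by simp
  show "continuous_on {0..1} (\<lambda>t::real. t/2)"
    by (intro continuous_intros) auto
  show "join_track (join_track p a) (rev_track a) (t, x) = join_track p a (?g t, x)" if "t \<in> {0..1}" "x \<in> topspace S" for t x
    using that trackD(2)[OF a] trackD(3)[OF p] by (auto simp: join_track_def rev_track_def algebra_simps)
  show "p (t, x) = join_track p a (t/2, x)" if "t \<in> {0..1}" "x \<in> topspace S" for t x
    using that by (auto simp: join_track_def)
qed (use p a in \<open>auto simp: join_track_def rev_track_def track_def\<close>)

lemma track_eq_left_cancel:
  assumes "track_eq S T u w (join_track a p) (join_track a q)" "track S T u v a" "track S T v w p" "track S T v w q"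
  shows "track_eq S T v w p q"
proof -
  have "track_eq S T v w p (join_track (rev_track a) (join_track a p))"
    by (rule track_eq_sym[OF track_eq_cancel_left_rev[OF assms(2,3)]])
  also have "track_eq S T v w \<dots> (join_track (rev_track a) (join_track a q))"
    by (rule track_eq_join[OF _ assms(1)]) (simp add: track_eq_refl track_rev[OF assms(2)])
  also have "track_eq S T v w \<dots> q"
    by (rule track_eq_cancel_left_rev[OF assms(2,4)])
  finally show ?thesis .
qed

lemma track_eq_right_cancel:
  assumes "track_eq S T u w (join_track p a) (join_track q a)" "track S T v w a" "track S T u v p" "track S T u v q"
  shows "track_eq S T u v p q"
proof -
  have "track_eq S T u v p (join_track (join_track p a) (rev_track a))"
    by (rule track_eq_sym[OF track_eq_cancel_right_rev[OF assms(3,2)]])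
  also have "track_eq S T u v \<dots> (join_track (join_track q a) (rev_track a))"
    by (rule track_eq_join[OF assms(1)]) (simp add: track_eq_refl track_rev[OF assms(2)])
  also have "track_eq S T u v \<dots> q"
    by (rule track_eq_cancel_right_rev[OF assms(4,2)])
  finally show ?thesis .
qed

text \<open>The two ways around the boundary from (0, 0) to (1, 1) are paths in a convex
  square.\<close>

lemma track_eq_square:
  assumes F: "continuous_map (prod_topology unit_interval (prod_topology unit_interval S)) T F"
    and p: "\<And>t x. t \<in> {0..1} \<Longrightarrow> x \<in> topspace S \<Longrightarrow> F (t, 0, x) = p (t, x)"
    and q: "\<And>t x. t \<in> {0..1} \<Longrightarrow> x \<in> topspace S \<Longrightarrow> F (1, t, x) = q (t, x)"
    and r: "\<And>t x. t \<in> {0..1} \<Longrightarrow> x \<in> topspace S \<Longrightarrow> F (0, t, x) = r (t, x)"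
    and s: "\<And>t x. t \<in> {0..1} \<Longrightarrow> x \<in> topspace S \<Longrightarrow> F (t, 1, x) = s (t, x)"
    and u: "\<And>x. x \<in> topspace S \<Longrightarrow> F (0, 0, x) = u x" and v: "\<And>x. x \<in> topspace S \<Longrightarrow> F (1, 1, x) = v x"
  shows "track_eq S T u v (join_track p q) (join_track r s)"
proof -
  let ?W = "{0..1::real} \<times> {0..1::real}"
  let ?F = "\<lambda>z. F (fst (fst z), snd (fst z), snd z)"
  let ?g = "\<lambda>t::real. if t \<le> 1/2 then (2 * t, 0) else (1, 2 * t - 1)"
  let ?h = "\<lambda>t::real. if t \<le> 1/2 then (0, 2 * t) else (2 * t - 1, 1)"
  have F': "continuous_map (prod_topology (top_of_set ?W) S) T ?F"
    unfolding prod_topology_subtopology_eu[symmetric]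
    by (rule continuous_map_apply[OF F] cont_rules)+
  have W: "convex ?W"
    by (intro convex_Times) auto
  have I: "{0..1/2} \<union> {1/2..1} = {0..1::real}"
    by auto
  have "continuous_on ({0..1/2} \<union> {1/2..1}) ?g" "continuous_on ({0..1/2} \<union> {1/2..1}) ?h"
    by (intro continuous_on_cases continuous_intros; auto)+
  then have "track_eq S T (\<lambda>x. ?F (?g 0, x)) (\<lambda>x. ?F (?g 1, x)) (\<lambda>z. ?F (?g (fst z), snd z)) (\<lambda>z. ?F (?h (fst z), snd z))"
    unfolding I by (intro track_eq_convex[OF F' W]) auto
  then show ?thesis
    by (rule track_eq_cong) (use p q r s u v in \<open>auto simp: join_track_def\<close>)
qed

subsection \<open>Tracks along a homotopy equivalence\<close>

lemma track_continuous_ends: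
  assumes "track S T u v p"
  shows "continuous_map S T u" "continuous_map S T v"
proof -
  have "continuous_map S T (\<lambda>x. p (c, x))" if "c \<in> {0..1}" for c
    by (intro continuous_map_apply[OF trackD(1)[OF assms]] continuous_map_pairedI
        continuous_map_id[unfolded id_def]) (use that in auto)
  from this[of 0] this[of 1] show "continuous_map S T u" "continuous_map S T v"
    using trackD(2,3)[OF assms] by (auto elim: continuous_map_eq)
qed

text \<open>The interchange law: \<open>p\<close> and \<open>J\<close> run in independent
  parameters, and \<open>p (s, J (t, x))\<close> fills the square they span.\<close>

lemma track_natural:
  assumes J: "track R S k l J" and p: "track S T u v p"
  shows "track_eq R T (\<lambda>x. u (k x)) (\<lambda>x. v (l x))
    (join_track (\<lambda>z. p (fst z, k (snd z))) (\<lambda>z. v (J z))) (join_track (\<lambda>z. u (J z)) (\<lambda>z. p (fst z, l (snd z))))"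
proof (rule track_eq_square[where F = "\<lambda>z. p (fst z, J (snd z))"])
  show "continuous_map (prod_topology unit_interval (prod_topology unit_interval R)) T (\<lambda>z. p (fst z, J (snd z)))"
    by (rule continuous_map_apply[OF trackD(1)[OF p]] continuous_map_apply[OF trackD(1)[OF J]] cont_rules)+
  have J': "J (t, x) \<in> topspace S" if "t \<in> {0..1}" "x \<in> topspace R" for t x
    using trackD(1)[OF J] that by (auto simp: continuous_map_def Pi_iff)
  have kl: "k x \<in> topspace S" "l x \<in> topspace S" if "x \<in> topspace R" for x
    using J'[of 0 x] J'[of 1 x] trackD(2,3)[OF J] that by auto
  fix t :: real and x assume *: "t \<in> {0..1}" "x \<in> topspace R"
  show "p (fst (t, 0, x), J (snd (t, 0::real, x))) = p (fst (t, x), k (snd (t, x)))"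
    "p (fst (1::real, t, x), J (snd (1::real, t, x))) = v (J (t, x))"
    "p (fst (0::real, t, x), J (snd (0::real, t, x))) = u (J (t, x))"
    "p (fst (t, 1, x), J (snd (t, 1::real, x))) = p (fst (t, x), l (snd (t, x)))"
    using * trackD(2,3)[OF J] trackD(2,3)[OF p] J' by auto
next
  have J': "J (t, x) \<in> topspace S" if "t \<in> {0..1}" "x \<in> topspace R" for t x
    using trackD(1)[OF J] that by (auto simp: continuous_map_def Pi_iff)
  fix x assume x: "x \<in> topspace R"
  show "p (fst (0::real, 0::real, x), J (snd (0::real, 0::real, x))) = u (k x)" "p (fst (1::real, 1::real, x), J (snd (1::real, 1::real, x))) = v (l x)"
    using x trackD(2,3)[OF J] trackD(2,3)[OF p] J'[of 0 x] J'[of 1 x] by auto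
qed

text \<open>Naturality along \<open>J\<close> expresses \<open>p\<close>, up to the invertible
  tracks \<open>u J\<close> and \<open>v J\<close>, through \<open>p\<close> precomposed with
  \<open>f\<close> and \<open>g\<close>; so the class of \<open>p\<close> is determined by its
  restriction along \<open>f\<close>.\<close>

lemma track_eq_precompose_inject:
  assumes J: "track B B (\<lambda>x. f (g x)) (\<lambda>x. x) J" and g: "continuous_map B E g"
    and p: "track B T u v p" and q: "track B T u v q"
    and pq: "track_eq E T (\<lambda>x. u (f x)) (\<lambda>x. v (f x)) (\<lambda>z. p (fst z, f (snd z))) (\<lambda>z. q (fst z, f (snd z)))"
  shows "track_eq B T u v p q"
proof (rule track_eq_left_cancel)
  have u: "track B T (\<lambda>x. u (f (g x))) u (\<lambda>z. u (J z))"
    using track_postcompose[OF J track_continuous_ends(1)[OF p]] by simp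
  have v: "track B T (\<lambda>x. v (f (g x))) v (\<lambda>z. v (J z))"
    using track_postcompose[OF J track_continuous_ends(2)[OF p]] by simp
  have "track_eq B T (\<lambda>x. u (f (g x))) v (join_track (\<lambda>z. u (J z)) p) (join_track (\<lambda>z. p (fst z, f (g (snd z)))) (\<lambda>z. v (J z)))"
    using track_eq_sym[OF track_natural[OF J p]] by simp
  also have "track_eq B T (\<lambda>x. u (f (g x))) v \<dots> (join_track (\<lambda>z. q (fst z, f (g (snd z)))) (\<lambda>z. v (J z)))"
    using track_eq_precompose[OF pq g] v by (auto intro!: track_eq_join simp: track_eq_refl)
  also have "track_eq B T (\<lambda>x. u (f (g x))) v \<dots> (join_track (\<lambda>z. u (J z)) q)"
    using track_natural[OF J q] by simp
  finally show "track_eq B T (\<lambda>x. u (f (g x))) v (join_track (\<lambda>z. u (J z)) p) (join_track (\<lambda>z. u (J z)) q)" .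
  show "track B T (\<lambda>x. u (f (g x))) u (\<lambda>z. u (J z))"
    by (fact u)
qed (fact p q)+

text \<open>The track \<open>a\<close> is precomposed with \<open>g\<close>, and its ends are
  corrected by \<open>u J\<close> and \<open>v J\<close>. The last conclusion is read off this
  formula and later gives the base point condition on \<open>m3\<close>.\<close>

lemma track_descend:
  assumes f: "continuous_map E B f" and g: "continuous_map B E g"
    and H: "track E E (\<lambda>x. g (f x)) (\<lambda>x. x) H" and J: "track B B (\<lambda>x. f (g x)) (\<lambda>x. x) J"
    and u: "continuous_map B T u" and v: "continuous_map B T v"
    and a: "track E T (\<lambda>x. u (f x)) (\<lambda>x. v (f x)) a"
  obtains p where "track B T u v p"
    and "track_eq E T (\<lambda>x. u (f x)) (\<lambda>x. v (f x)) (\<lambda>z. p (fst z, f (snd z))) a"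
    and "\<And>b0 e0 c t. \<lbrakk>\<forall>t\<in>{0..1}. J (t, b0) = b0; g b0 = e0; \<forall>t\<in>{0..1}. a (t, e0) = c; u b0 = c; v b0 = c; t \<in> {0..1}\<rbrakk>
      \<Longrightarrow> p (t, b0) = c"
proof -
  let ?ag = "\<lambda>z. a (fst z, g (snd z))"
  define p where "p = join_track (rev_track (\<lambda>z. u (J z))) (join_track ?ag (\<lambda>z. v (J z)))"
  have uJ: "track B T (\<lambda>x. u (f (g x))) u (\<lambda>z. u (J z))"
    using track_postcompose[OF J u] by simp
  have vJ: "track B T (\<lambda>x. v (f (g x))) v (\<lambda>z. v (J z))"
    using track_postcompose[OF J v] by simp
  have ag: "track B T (\<lambda>x. u (f (g x))) (\<lambda>x. v (f (g x))) ?ag"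
    using track_precompose[OF a g] by simp
  have p: "track B T u v p"
    unfolding p_def by (intro track_join[OF track_rev[OF uJ]] track_join[OF ag vJ])
  let ?pf = "\<lambda>z. p (fst z, f (snd z))"
  \<comment> \<open>Naturality along \<open>J\<close> first compares \<open>p\<close> and
    \<open>a\<close> after precomposition with \<open>g\<close>. Precomposing with \<open>f\<close>
    leaves a surplus \<open>g (f x)\<close>, which naturality along \<open>H\<close> then
    removes.\<close>
  have "track_eq B T (\<lambda>x. u (f (g x))) v (join_track (\<lambda>z. p (fst z, f (g (snd z)))) (\<lambda>z. v (J z))) (join_track (\<lambda>z. u (J z)) p)"
    using track_natural[OF J p] by simp
  also have "track_eq B T (\<lambda>x. u (f (g x))) v \<dots> (join_track ?ag (\<lambda>z. v (J z)))"
    unfolding p_def using track_eq_cancel_left_rev[OF track_rev[OF uJ] track_join[OF ag vJ]] by simp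
  finally have "track_eq B T (\<lambda>x. u (f (g x))) (\<lambda>x. v (f (g x))) (\<lambda>z. p (fst z, f (g (snd z)))) ?ag"
    by (rule track_eq_right_cancel) (use vJ ag track_precompose[OF track_precompose[OF p f] g] in auto)
  from track_eq_precompose[OF this f]
  have pag: "track_eq E T (\<lambda>x. u (f (g (f x)))) (\<lambda>x. v (f (g (f x)))) (\<lambda>z. p (fst z, f (g (f (snd z))))) (\<lambda>z. a (fst z, g (f (snd z))))"
    by simp
  have pf: "track E T (\<lambda>x. u (f x)) (\<lambda>x. v (f x)) ?pf"
    by (rule track_precompose[OF p f])
  have uH: "track E T (\<lambda>x. u (f (g (f x)))) (\<lambda>x. u (f x)) (\<lambda>z. u (f (H z)))"
    using track_postcompose[OF track_postcompose[OF H f] u] by simp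
  have vH: "track E T (\<lambda>x. v (f (g (f x)))) (\<lambda>x. v (f x)) (\<lambda>z. v (f (H z)))"
    using track_postcompose[OF track_postcompose[OF H f] v] by simp
  have "track_eq E T (\<lambda>x. u (f (g (f x)))) (\<lambda>x. v (f x)) (join_track (\<lambda>z. u (f (H z))) ?pf) (join_track (\<lambda>z. p (fst z, f (g (f (snd z))))) (\<lambda>z. v (f (H z))))"
    using track_eq_sym[OF track_natural[OF H pf]] by simp
  also have "track_eq E T (\<lambda>x. u (f (g (f x)))) (\<lambda>x. v (f x)) \<dots> (join_track (\<lambda>z. a (fst z, g (f (snd z)))) (\<lambda>z. v (f (H z))))"
    using pag vH by (auto intro!: track_eq_join simp: track_eq_refl)
  also have "track_eq E T (\<lambda>x. u (f (g (f x)))) (\<lambda>x. v (f x)) \<dots> (join_track (\<lambda>z. u (f (H z))) a)"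
    using track_natural[OF H a] by simp
  finally have "track_eq E T (\<lambda>x. u (f x)) (\<lambda>x. v (f x)) ?pf a"
    by (rule track_eq_left_cancel) (use uH pf a in auto)
  moreover have "p (t, b0) = c"
    if "\<forall>t\<in>{0..1}. J (t, b0) = b0" "g b0 = e0" "\<forall>t\<in>{0..1}. a (t, e0) = c" "u b0 = c" "v b0 = c" "t \<in> {0..1}" for b0 e0 c t
    using that by (auto simp: p_def join_track_def rev_track_def)
  ultimately show thesis
    using that p by blast
qed

section \<open>Based homotopy equivalences: extraction of the data, composition, products\<close>

lemma based_homotopic_track:
  assumes "based_homotopic A a0 B b0 f g"
  obtains H where "track A B f g H" "\<forall>t\<in>{0..1}. H (t, a0) = b0"
  using assms that unfolding based_homotopic_def homotopic_with_def track_def by blast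

lemma based_heqE:
  assumes "based_heq A a0 B b0 f"
  obtains g H J where "continuous_map A B f" "f a0 = b0" "based_homotopy_inverse A a0 B b0 f g"
    and "continuous_map B A g" "g b0 = a0"
    and "track A A (\<lambda>x. g (f x)) (\<lambda>x. x) H" "\<forall>t\<in>{0..1}. H (t, a0) = a0"
    and "track B B (\<lambda>x. f (g x)) (\<lambda>x. x) J" "\<forall>t\<in>{0..1}. J (t, b0) = b0"
proof -
  obtain g where inv: "based_homotopy_inverse A a0 B b0 f g" and f: "based_map A a0 B b0 f"
    using assms by (auto simp: based_heq_def)
  then have g: "based_map B b0 A a0 g"
    and gf: "based_homotopic A a0 A a0 (g \<circ> f) id" and fg: "based_homotopic B b0 B b0 (f \<circ> g) id"
    by (auto simp: based_homotopy_inverse_def)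
  obtain H where "track A A (g \<circ> f) id H" "\<forall>t\<in>{0..1}. H (t, a0) = a0"
    by (rule based_homotopic_track[OF gf])
  moreover obtain J where "track B B (f \<circ> g) id J" "\<forall>t\<in>{0..1}. J (t, b0) = b0"
    by (rule based_homotopic_track[OF fg])
  ultimately show thesis
    using that[of g H J] f g inv by (simp add: based_map_def o_def id_def)
qed

lemma based_heq_compose:
  assumes f: "based_heq A a0 B b0 f" and h: "based_heq B b0 C c0 h"
  shows "based_heq A a0 C c0 (h \<circ> f)"
proof -
  obtain g where f: "based_map A a0 B b0 f" and g: "based_map B b0 A a0 g"
    and gf: "based_homotopic A a0 A a0 (g \<circ> f) id" and fg: "based_homotopic B b0 B b0 (f \<circ> g) id"
    using f by (auto simp: based_heq_def based_homotopy_inverse_def)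
  obtain k where h: "based_map B b0 C c0 h" and k: "based_map C c0 B b0 k"
    and kh: "based_homotopic B b0 B b0 (k \<circ> h) id" and hk: "based_homotopic C c0 C c0 (h \<circ> k) id"
    using h by (auto simp: based_heq_def based_homotopy_inverse_def)
  \<comment> \<open>In a composite of two equivalences the inner pair \<open>m\<close> contracts to
    the identity between the outer maps; this is applied on both sides.\<close>
  have sandwich: "based_homotopic X x0 X x0 (s \<circ> r) id"
    if "based_homotopic Y y0 Y y0 m id" "based_homotopic X x0 X x0 (q \<circ> r) id"
      "based_map X x0 Y y0 r" "based_map Y y0 X x0 q" "s = q \<circ> m"
    for X :: "'x topology" and Y :: "'y topology" and x0 y0 m q r s
  proof -
    have "homotopic_with (\<lambda>k. k x0 = x0) X X (q \<circ> (m \<circ> r)) (q \<circ> (id \<circ> r))"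
      using that unfolding based_homotopic_def based_map_def
      by (intro homotopic_with_compose_continuous_map_left[where p = "\<lambda>k. k x0 = y0"]
          homotopic_with_compose_continuous_map_right[where p = "\<lambda>k. k y0 = y0"]) auto
    then have "homotopic_with (\<lambda>k. k x0 = x0) X X (s \<circ> r) (q \<circ> r)"
      using that(5) by (simp add: o_assoc)
    then show ?thesis
      using that(2) homotopic_with_trans unfolding based_homotopic_def by blast
  qed
  have "based_homotopic A a0 A a0 ((g \<circ> k) \<circ> (h \<circ> f)) id"
    using sandwich[OF kh gf f g refl] by (simp add: o_assoc)
  moreover have "based_homotopic C c0 C c0 ((h \<circ> f) \<circ> (g \<circ> k)) id"
    using sandwich[OF fg hk k h refl] by (simp add: o_assoc)
  ultimately show ?thesis
    using f g h k unfolding based_heq_def based_homotopy_inverse_def based_map_def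
    by (auto intro!: exI[of _ "g \<circ> k"] continuous_map_compose)
qed

lemma based_heq_prod_right:
  assumes "based_heq A a0 B b0 f" and c0: "c0 \<in> topspace C"
  shows "based_heq (prod_topology C A) (c0, a0) (prod_topology C B) (c0, b0) (\<lambda>z. (fst z, f (snd z)))"
proof -
  obtain g where f: "based_map A a0 B b0 f" and g: "based_map B b0 A a0 g"
    and gf: "based_homotopic A a0 A a0 (g \<circ> f) id" and fg: "based_homotopic B b0 B b0 (f \<circ> g) id"
    using assms by (auto simp: based_heq_def based_homotopy_inverse_def)
  have lift: "based_map (prod_topology C X) (c0, x0) (prod_topology C Y) (c0, y0) (\<lambda>z. (fst z, q (snd z)))"
    if "based_map X x0 Y y0 q" for X :: "'x topology" and Y :: "'y topology" and x0 y0 q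
    using that unfolding based_map_def
    by (auto intro!: continuous_map_pairedI continuous_map_apply[of X] continuous_map_fst continuous_map_snd)
  have hom: "based_homotopic (prod_topology C X) (c0, x0) (prod_topology C X) (c0, x0) (\<lambda>z. (fst z, q (snd z))) id"
    if "based_homotopic X x0 X x0 q id" for X :: "'x topology" and x0 q
    using homotopic_with_prod_topology[of "\<lambda>k. k c0 = c0" C C id id "\<lambda>k. k x0 = x0" X X q id
        "\<lambda>k. k (c0, x0) = (c0, x0)"] that
    unfolding based_homotopic_def by (simp add: id_def)
  show ?thesis
    unfolding based_heq_def based_homotopy_inverse_def
    using lift[OF f] lift[OF g] hom[OF gf] hom[OF fg]
    by (intro conjI exI[of _ "\<lambda>z. (fst z, g (snd z))"]) (simp_all add: o_def)
qed

subsection \<open>Filling the pentagon\<close>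

text \<open>The bounding lines carry the edges P0P1, P1P2, P2P3, P3P4, P4P0 in this order.
  Half-planes are convex, so testing the five vertices suffices.\<close>

lemma K4set_subset:
  assumes "(x, y) \<in> K4set"
  shows "0 \<le> y" "x - y \<le> 2" "x + 2 * y \<le> 5" "2 * y - x \<le> 3" "0 \<le> x + y"
proof -
  let ?Q = "{z::real \<times> real. 0 \<le> snd z \<and> fst z - snd z \<le> 2 \<and> fst z + 2 * snd z \<le> 5 \<and> 2 * snd z - fst z \<le> 3 \<and> 0 \<le> fst z + snd z}"
  have "?Q = {z. (0, -1) \<bullet> z \<le> 0} \<inter> {z. (1, -1) \<bullet> z \<le> 2} \<inter> {z. (1, 2) \<bullet> z \<le> 5} \<inter> {z. (-1, 2) \<bullet> z \<le> 3}
     \<inter> {z. (-1, -1) \<bullet> z \<le> (0::real)}"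
    by (auto simp: inner_prod_def)
  then have "convex ?Q"
    by (simp only: convex_Int convex_halfspace_le)
  then have "K4set \<subseteq> ?Q"
    unfolding K4set_def by (intro hull_minimal) (auto simp: P0_def P1_def P2_def P3_def P4_def)
  then show "0 \<le> y" "x - y \<le> 2" "x + 2 * y \<le> 5" "2 * y - x \<le> 3" "0 \<le> x + y"
    using assms by auto
qed

text \<open>The breakpoints 1/2 and 3/4 are those of
  \<open>join_track p1 (join_track p2 p3)\<close>.\<close>

definition pentagon_lower :: "real \<Rightarrow> real \<times> real" where
  "pentagon_lower t = (if t \<le> 1/2 then seg P0 P1 (2 * t) else if t \<le> 3/4 then seg P1 P2 (4 * t - 2) else seg P2 P3 (4 * t - 3))"

text \<open>The second edge is reparametrised so that for every \<open>t\<close> the points \<open>pentagon_lower t\<close> and \<open>pentagon_upper t\<close> lie on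
  the same line \<open>x + 3 y = c\<close>; these parallel segments pentagon_sweep out the pentagon.\<close>
definition pentagon_speed :: "real \<Rightarrow> real" where
  "pentagon_speed t = (if t \<le> 1/2 then 8 * t / 5 else (3 + 2 * t) / 5)"

definition pentagon_upper :: "real \<Rightarrow> real \<times> real" where
  "pentagon_upper t = (if t \<le> 1/2 then seg P0 P4 (2 * t) else seg P4 P3 (pentagon_speed (2 * t - 1)))"

definition pentagon_sweep :: "real \<times> real \<Rightarrow> real \<times> real" where
  "pentagon_sweep w = (1 - fst w) *\<^sub>R pentagon_lower (snd w) + fst w *\<^sub>R pentagon_upper (snd w)"

text \<open>The value of x + 3 y on \<open>pentagon_lower t\<close>; it is 0, 2, 6, 7 at P0, P1, P2,
  P3. The coefficient 3 makes P1 and P4, both reached at parameter 1/2, have the same level 2. On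
  the edge from P4 to P3 the level is 2 + 5 s, and solving for s gives
  \<open>pentagon_speed\<close>.\<close>

definition pentagon_level :: "real \<Rightarrow> real" where
  "pentagon_level t = (if t \<le> 1/2 then 4 * t else if t \<le> 3/4 then 16 * t - 6 else 3 + 4 * t)"

text \<open>The difference of the first coordinates of \<open>pentagon_lower t\<close> and
  \<open>pentagon_upper t\<close>. Within the unit interval it vanishes only at 0 and 1.\<close>

definition pentagon_width :: "real \<Rightarrow> real" where
  "pentagon_width t = (if t \<le> 1/2 then 6 * t else if t \<le> 3/4 then (21 - 12 * t) / 5 else (48 - 48 * t) / 5)"

lemmas P_defs = P0_def P1_def P2_def P3_def P4_def seg_def

lemma pentagon_sweep_coords:
  "fst (pentagon_sweep (s, t)) = fst (pentagon_lower t) - s * pentagon_width t"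
  "fst (pentagon_sweep (s, t)) + 3 * snd (pentagon_sweep (s, t)) = pentagon_level t"
  by (auto simp: pentagon_sweep_def pentagon_lower_def pentagon_upper_def pentagon_speed_def pentagon_level_def pentagon_width_def P_defs field_simps)

lemma pentagon_level_inj:
  assumes "pentagon_level t = pentagon_level t'" shows "t = t'"
  using assms by (auto simp: pentagon_level_def split: if_splits)

lemma pentagon_width_pos: "0 < t \<Longrightarrow> t < 1 \<Longrightarrow> 0 < pentagon_width t"
  by (auto simp: pentagon_width_def)

text \<open>The level determines \<open>t\<close>, and the first coordinate determines
  \<open>s\<close> where the width is positive. Hence the sweep identifies points only within the
  sides \<open>t = 0\<close> and \<open>t = 1\<close> of the square.\<close>

lemma pentagon_sweep_inj:
  assumes "pentagon_sweep (s, t) = pentagon_sweep (s', t')" "t \<in> {0..1}"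
  shows "t = t'" "t = 0 \<or> t = 1 \<or> s = s'"
proof -
  show "t = t'"
    using pentagon_sweep_coords(2)[of s t] pentagon_sweep_coords(2)[of s' t'] assms(1) pentagon_level_inj by metis
  then have "s * pentagon_width t = s' * pentagon_width t"
    using pentagon_sweep_coords(1)[of s t] pentagon_sweep_coords(1)[of s' t'] assms(1) by auto
  then show "t = 0 \<or> t = 1 \<or> s = s'"
    using pentagon_width_pos[of t] assms(2) by fastforce
qed

lemma seg_in_K4set:
  assumes "t \<in> {0..1}"
  shows "seg P0 P1 t \<in> K4set" "seg P1 P2 t \<in> K4set" "seg P2 P3 t \<in> K4set" "seg P0 P4 t \<in> K4set" "seg P4 P3 t \<in> K4set"
proof -
  have "seg p q t \<in> K4set" if "p \<in> {P0, P1, P2, P3, P4}" "q \<in> {P0, P1, P2, P3, P4}" for p q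
    unfolding seg_def K4set_def using assms that
    by (intro convexD[OF convex_convex_hull] hull_inc) auto
  then show "seg P0 P1 t \<in> K4set" "seg P1 P2 t \<in> K4set" "seg P2 P3 t \<in> K4set" "seg P0 P4 t \<in> K4set" "seg P4 P3 t \<in> K4set"
    by auto
qed

lemma pentagon_speed_in: "t \<in> {0..1} \<Longrightarrow> pentagon_speed t \<in> {0..1}"
  by (auto simp: pentagon_speed_def)

lemma pentagon_sweep_in_K4set:
  assumes "s \<in> {0..1}" "t \<in> {0..1}" shows "pentagon_sweep (s, t) \<in> K4set"
proof -
  have "pentagon_lower t \<in> K4set"
    unfolding pentagon_lower_def using assms(2) by (auto intro!: seg_in_K4set)
  moreover have "pentagon_upper t \<in> K4set"
    unfolding pentagon_upper_def using assms(2) by (auto intro!: seg_in_K4set pentagon_speed_in)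
  moreover have "convex K4set"
    by (simp add: K4set_def)
  ultimately show ?thesis
    unfolding pentagon_sweep_def using assms(1) by (auto intro!: convexD)
qed

lemma pentagon_sweep_surj:
  assumes "(x, y) \<in> K4set"
  obtains s t where "s \<in> {0..1}" "t \<in> {0..1}" "pentagon_sweep (s, t) = (x, y)"
proof -
  note K = K4set_subset[OF assms]
  \<comment> \<open>The inverse of \<open>pentagon_level\<close>, branch by branch; the thresholds 2
    and 6 are the levels of P1 and P2.\<close>
  define t where "t = (if x + 3 * y \<le> 2 then (x + 3 * y) / 4
      else if x + 3 * y \<le> 6 then (x + 3 * y + 6) / 16 else (x + 3 * y - 3) / 4)"
  have t: "t \<in> {0..1}" and lev: "pentagon_level t = x + 3 * y"
    using K by (auto simp: t_def pentagon_level_def add_divide_distrib diff_divide_distrib)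
  have lo: "x \<le> fst (pentagon_lower t)"
    using K by (auto simp: t_def pentagon_lower_def P_defs field_simps)
  have up: "fst (pentagon_lower t) - pentagon_width t \<le> x"
    using K by (auto simp: t_def pentagon_lower_def pentagon_width_def P_defs field_simps)
  \<comment> \<open>Zero width occurs only at P0 and P3, where every \<open>s\<close> gives the same
    point; 0 is taken.\<close>
  define s where "s = (if pentagon_width t = 0 then 0 else (fst (pentagon_lower t) - x) / pentagon_width t)"
  have w: "0 \<le> pentagon_width t"
    using t by (auto simp: pentagon_width_def)
  have s: "s \<in> {0..1}" and sw: "s * pentagon_width t = fst (pentagon_lower t) - x"
    using lo up w by (auto simp: s_def field_simps)
  have "fst (pentagon_sweep (s, t)) = x" "fst (pentagon_sweep (s, t)) + 3 * snd (pentagon_sweep (s, t)) = x + 3 * y"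
    using pentagon_sweep_coords[of s t] sw lev by auto
  then have "pentagon_sweep (s, t) = (x, y)"
    by (simp add: prod_eq_iff)
  then show thesis
    using that s t by blast
qed

lemma pentagon_speed_ends [simp]: "pentagon_speed 0 = 0" "pentagon_speed 1 = 1"
  by (auto simp: pentagon_speed_def)

lemma continuous_on_pentagon_speed: "continuous_on {0..1} pentagon_speed"
proof -
  have "continuous_on ({0..1/2} \<union> {1/2..1}) (\<lambda>t::real. if t \<le> 1/2 then 8 * t / 5 else (3 + 2 * t) / 5)"
    by (intro continuous_on_cases continuous_intros) auto
  moreover have "{0..1/2} \<union> {1/2..1} = {0..1::real}"
    by auto
  ultimately show ?thesis
    by (simp add: pentagon_speed_def[abs_def])
qed

lemma continuous_on_pentagon_lower: "continuous_on {0..1} pentagon_lower"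
proof -
  have "continuous_on ({1/2..3/4} \<union> {3/4..1})
      (\<lambda>t. if t \<le> 3/4 then seg P1 P2 (4 * t - 2) else seg P2 P3 (4 * t - 3))"
    unfolding seg_def by (intro continuous_on_cases continuous_intros) (auto simp: P_defs field_simps)
  moreover have "{1/2..3/4} \<union> {3/4..1} = {1/2..1::real}"
    by auto
  moreover have "(1 - 2 * t) *\<^sub>R P0 + (2 * t) *\<^sub>R P1 = (3 - 4 * t) *\<^sub>R P1 + (4 * t - 2) *\<^sub>R P2" if "t * 2 = 1" for t
    using that by (auto simp: P_defs field_simps)
  ultimately have "continuous_on ({0..1/2} \<union> {1/2..1}) pentagon_lower"
    unfolding pentagon_lower_def[abs_def] by (intro continuous_on_cases) (auto simp: seg_def intro!: continuous_intros)
  moreover have "{0..1/2} \<union> {1/2..1} = {0..1::real}"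
    by auto
  ultimately show ?thesis
    by simp
qed

lemma continuous_on_pentagon_upper: "continuous_on {0..1} pentagon_upper"
proof -
  have "continuous_on ({0..1/2} \<union> {1/2..1}) pentagon_upper"
    unfolding pentagon_upper_def[abs_def] seg_def
    by (intro continuous_on_cases continuous_intros continuous_on_compose2[OF continuous_on_pentagon_speed])
       (auto simp: pentagon_speed_def P_defs field_simps)
  moreover have "{0..1/2} \<union> {1/2..1} = {0..1::real}"
    by auto
  ultimately show ?thesis
    by simp
qed

lemma continuous_on_pentagon_sweep: "continuous_on ({0..1} \<times> {0..1}) pentagon_sweep"
  unfolding pentagon_sweep_def
  by (intro continuous_intros continuous_on_compose2[OF continuous_on_pentagon_lower] continuous_on_compose2[OF continuous_on_pentagon_upper]) auto

text \<open>A homotopy relative to the ends is a map on the square times \<open>S\<close> that is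
  constant in s where t is 0 or 1. The sweep collapses just these two sides, so the map descends to
  \<open>K4\<close>.\<close>

lemma pentagon_fill:
  assumes p1: "track S T v0 v1 p1" and p2: "track S T v1 v2 p2" and p3: "track S T v2 v3 p3"
    and p4: "track S T v0 v4 p4" and p5: "track S T v4 v3 p5"
    and eq: "track_eq S T v0 v3 (join_track p1 (join_track p2 p3)) (join_track p4 p5)"
  obtains G where "continuous_map (prod_topology K4 S) T G"
    and "\<And>t x. t \<in> {0..1} \<Longrightarrow> x \<in> topspace S \<Longrightarrow>
      G (seg P0 P1 t, x) = p1 (t, x) \<and> G (seg P1 P2 t, x) = p2 (t, x) \<and> G (seg P2 P3 t, x) = p3 (t, x) \<and>
      G (seg P0 P4 t, x) = p4 (t, x) \<and> G (seg P4 P3 t, x) = p5 (t, x)"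
proof -
  \<comment> \<open>\<open>pentagon_upper\<close> runs along its second edge with
    \<open>pentagon_speed\<close>. Reparametrising \<open>p5\<close> in the same way changes it only
    up to homotopy relative to the ends.\<close>
  let ?p5 = "\<lambda>z. p5 (pentagon_speed (fst z), snd z)"
  have "track_eq S T v4 v3 p5 ?p5"
    by (rule track_eq_reparam[OF trackD(1)[OF p5], where g = "\<lambda>t. t" and h = pentagon_speed])
       (use trackD(2,3)[OF p5] pentagon_speed_in in \<open>auto simp: continuous_on_pentagon_speed\<close>)
  then have "track_eq S T v0 v3 (join_track p1 (join_track p2 p3)) (join_track p4 ?p5)"
    using eq track_eq_join[of S T v0 v4 p4 p4 v3 p5 ?p5] p4 track_eq_trans by (auto simp: track_eq_refl)
  then obtain F where F: "continuous_map (prod_topology unit_interval (prod_topology unit_interval S)) T F"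
    and F_ends: "\<forall>t\<in>{0..1}. \<forall>x\<in>topspace S. F (0, t, x) = join_track p1 (join_track p2 p3) (t, x) \<and>
        F (1, t, x) = join_track p4 ?p5 (t, x) \<and> F (t, 0, x) = v0 x \<and> F (t, 1, x) = v3 x"
    unfolding track_eq_iff by blast
  let ?I = "prod_topology unit_interval unit_interval"
  let ?q = "\<lambda>(w, x). (pentagon_sweep w, x)"
  \<comment> \<open>A chosen preimage under the sweep. It is ambiguous only over P0 and P3, where
    \<open>F\<close> does not depend on its first argument.\<close>
  define r where "r = (\<lambda>z. SOME w. w \<in> {0..1} \<times> {0..1} \<and> pentagon_sweep w = z)"
  define G where "G = (\<lambda>(z, x). F (fst (r z), snd (r z), x))"
  have r: "r (pentagon_sweep w) \<in> {0..1} \<times> {0..1}" "pentagon_sweep (r (pentagon_sweep w)) = pentagon_sweep w" if "w \<in> {0..1} \<times> {0..1}" for w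
    using someI[where P = "\<lambda>w'. w' \<in> {0..1} \<times> {0..1} \<and> pentagon_sweep w' = pentagon_sweep w", of w] that
    unfolding r_def by auto
  have G_sweep: "G (pentagon_sweep (s, t), x) = F (s, t, x)" if "s \<in> {0..1}" "t \<in> {0..1}" "x \<in> topspace S" for s t x
  proof -
    obtain s' t' where w: "r (pentagon_sweep (s, t)) = (s', t')"
      by fastforce
    then have "s' \<in> {0..1}" "t' \<in> {0..1}" "pentagon_sweep (s', t') = pentagon_sweep (s, t)"
      using r[of "(s, t)"] that by auto
    then have "t' = t" "t = 0 \<or> t = 1 \<or> s' = s"
      using pentagon_sweep_inj[of s' t' s t] by auto
    then show ?thesis
      unfolding G_def using w F_ends that \<open>s' \<in> {0..1}\<close> by auto
  qed
  have pentagon_sweep: "continuous_map ?I K4 pentagon_sweep"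
    using continuous_on_pentagon_sweep pentagon_sweep_in_K4set
    by (auto simp: K4_def prod_topology_subtopology_eu)
  \<comment> \<open>A continuous map from a compact to a Hausdorff space is proper, and properness
    survives multiplication with the identity of an arbitrary \<open>S\<close>. A closed continuous
    surjection is then a quotient map.\<close>
  have "closed_map (prod_topology ?I S) (prod_topology K4 S) ?q"
  proof (rule proper_imp_closed_map, subst proper_map_prod, intro disjI2 conjI)
    have "compact_space ?I" "Hausdorff_space K4"
      by (simp_all add: compact_space_subtopology compact_Times K4_def Hausdorff_space_subtopology)
    then show "proper_map ?I K4 pentagon_sweep"
      using pentagon_sweep by (simp add: continuous_imp_proper_map Hausdorff_imp_kc_space)
    show "proper_map S S (\<lambda>x. x)"
      using proper_map_id by (simp add: id_def)
  qed
  moreover have "continuous_map (prod_topology ?I S) (prod_topology K4 S) ?q"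
    unfolding case_prod_unfold
    by (rule continuous_map_pairedI continuous_map_apply[OF pentagon_sweep] continuous_map_fst continuous_map_snd)+
  moreover have "?q ` topspace (prod_topology ?I S) = topspace (prod_topology K4 S)"
  proof -
    have "pentagon_sweep ` ({0..1} \<times> {0..1}) = K4set"
    proof (intro equalityI subsetI)
      show "z \<in> pentagon_sweep ` ({0..1} \<times> {0..1})" if "z \<in> K4set" for z
        using pentagon_sweep_surj[of "fst z" "snd z"] that by (metis image_eqI mem_Sigma_iff prod.collapse)
    qed (use pentagon_sweep_in_K4set in auto)
    moreover have "?q ` (A \<times> topspace S) = (pentagon_sweep ` A) \<times> topspace S" for A
      by (auto simp: image_iff)
    ultimately have "?q ` (({0..1} \<times> {0..1}) \<times> topspace S) = K4set \<times> topspace S"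
      by simp
    then show ?thesis
      by (simp add: K4_def)
  qed
  ultimately have q: "quotient_map (prod_topology ?I S) (prod_topology K4 S) ?q"
    by (intro continuous_closed_imp_quotient_map)
  have "continuous_map (prod_topology ?I S) T (\<lambda>z. F (fst (fst z), snd (fst z), snd z))"
    by (rule continuous_map_apply[OF F] cont_rules)+
  then have "continuous_map (prod_topology ?I S) T (G \<circ> ?q)"
    by (rule continuous_map_eq) (auto simp: G_sweep)
  then have "continuous_map (prod_topology K4 S) T G"
    by (rule continuous_compose_quotient_map[OF q])
  moreover have "G (seg P0 P1 t, x) = p1 (t, x) \<and> G (seg P1 P2 t, x) = p2 (t, x) \<and> G (seg P2 P3 t, x) = p3 (t, x) \<and>
      G (seg P0 P4 t, x) = p4 (t, x) \<and> G (seg P4 P3 t, x) = p5 (t, x)"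
    if "t \<in> {0..1}" "x \<in> topspace S" for t x
  proof -
    have lo: "G (pentagon_lower t', x) = join_track p1 (join_track p2 p3) (t', x)" and up: "G (pentagon_upper t', x) = join_track p4 ?p5 (t', x)"
      if "t' \<in> {0..1}" for t'
      using G_sweep[of 0 t' x] G_sweep[of 1 t' x] F_ends that \<open>x \<in> topspace S\<close> by (auto simp: pentagon_sweep_def)
    have 1: "pentagon_lower (t/2) = seg P0 P1 t" "join_track p1 (join_track p2 p3) (t/2, x) = p1 (t, x)"
      using that by (auto simp: pentagon_lower_def join_track_def)
    \<comment> \<open>At \<open>t = 0\<close> the parameter is a breakpoint and falls into the
      preceding branch, so the two edges are compared at their common vertex.\<close>
    have 2: "pentagon_lower (1/2 + t/4) = seg P1 P2 t" "join_track p1 (join_track p2 p3) (1/2 + t/4, x) = p2 (t, x)"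
      using that trackD(3)[OF p1] trackD(2)[OF p2]
      by (cases "t = 0"; auto simp: pentagon_lower_def join_track_def seg_def algebra_simps)+
    have 3: "pentagon_lower (3/4 + t/4) = seg P2 P3 t" "join_track p1 (join_track p2 p3) (3/4 + t/4, x) = p3 (t, x)"
      using that trackD(3)[OF p2] trackD(2)[OF p3]
      by (cases "t = 0"; auto simp: pentagon_lower_def join_track_def seg_def algebra_simps)+
    have 4: "pentagon_upper (t/2) = seg P0 P4 t" "join_track p4 ?p5 (t/2, x) = p4 (t, x)"
      using that by (auto simp: pentagon_upper_def join_track_def)
    \<comment> \<open>The inverse of \<open>pentagon_speed\<close> at \<open>t\<close>.\<close>
    define r where "r = (if t \<le> 4/5 then 5 * t / 8 else (5 * t - 3) / 2)"
    have r: "r \<in> {0..1}" "pentagon_speed r = t" "2 * (1/2 + r/2) - 1 = r"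
      using that by (auto simp: r_def pentagon_speed_def field_simps)
    have 5: "pentagon_upper (1/2 + r/2) = seg P4 P3 t" "join_track p4 ?p5 (1/2 + r/2, x) = p5 (t, x)"
    proof -
      have "r = 0 \<Longrightarrow> t = 0"
        using r(2) by (simp add: pentagon_speed_def)
      then show "pentagon_upper (1/2 + r/2) = seg P4 P3 t" "join_track p4 ?p5 (1/2 + r/2, x) = p5 (t, x)"
        using r that trackD(3)[OF p4] trackD(2)[OF p5]
        by (cases "r = 0"; auto simp: pentagon_upper_def join_track_def seg_def)+
    qed
    show ?thesis
      using 1 2 3 4 5 lo[of "t/2"] lo[of "1/2 + t/4"] lo[of "3/4 + t/4"] up[of "t/2"] up[of "1/2 + r/2"] that r(1)
      by auto
  qed
  ultimately show thesis
    using that by blast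
qed

subsection \<open>The pentagon over the fourth space\<close>

lemma track_cong:
  assumes "track S T u v p" "\<And>x. x \<in> topspace S \<Longrightarrow> u' x = u x" "\<And>x. x \<in> topspace S \<Longrightarrow> v' x = v x"
  shows "track S T u' v' p"
  using assms by (simp add: track_def)

text \<open>Pastes two cells along their common edge \<open>s\<close>. In the applications
  \<open>1\<close> is a naturality square of \<open>m3\<close> against \<open>eta\<close>, and
  \<open>2\<close> is the relation defining \<open>m3\<close>, evaluated at some
  \<open>d i\<close>.\<close>

lemma track_eq_prism:
  assumes q: "track S T v v' q" and b1: "track S T v y b1" and b2: "track S T y m b2" and c1: "track S T v' y' c1"
    and c2: "track S T y' m' c2" and e: "track S T m w e" and e': "track S T m' w e'" and s: "track S T y y' s"
    and 1: "track_eq S T v y' (join_track q c1) (join_track b1 s)" and 2: "track_eq S T y w (join_track s (join_track c2 e')) (join_track b2 e)"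
  shows "track_eq S T v w (join_track q (join_track (join_track c1 c2) e')) (join_track (join_track b1 b2) e)"
proof -
  have "track_eq S T v w (join_track q (join_track (join_track c1 c2) e')) (join_track q (join_track c1 (join_track c2 e')))"
    by (rule track_eq_join[OF _ track_eq_join_assoc[OF c1 c2 e']]) (simp add: track_eq_refl q)
  also have "track_eq S T v w \<dots> (join_track (join_track q c1) (join_track c2 e'))"
    by (rule track_eq_sym[OF track_eq_join_assoc[OF q c1 track_join[OF c2 e']]])
  also have "track_eq S T v w \<dots> (join_track (join_track b1 s) (join_track c2 e'))"
    by (intro track_eq_join[OF 1]) (simp add: track_eq_refl track_join[OF c2 e'])
  also have "track_eq S T v w \<dots> (join_track b1 (join_track s (join_track c2 e')))"
    by (rule track_eq_join_assoc[OF b1 s track_join[OF c2 e']])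
  also have "track_eq S T v w \<dots> (join_track b1 (join_track b2 e))"
    by (intro track_eq_join[OF _ 2]) (simp add: track_eq_refl b1)
  also have "track_eq S T v w \<dots> (join_track (join_track b1 b2) e)"
    by (rule track_eq_sym[OF track_eq_join_assoc[OF b1 b2 e]])
  finally show ?thesis .
qed

text \<open>The five triangles share the apex \<open>w\<close>. Both routes from \<open>v0\<close>
  to \<open>v3\<close>, continued by \<open>k3\<close>, reduce to \<open>k0\<close>, and
  \<open>k3\<close> can be cancelled.\<close>

lemma track_eq_pentagon_cone:
  assumes q1: "track S T v0 v1 q1" and q2: "track S T v1 v2 q2" and q3: "track S T v2 v3 q3"
    and q4: "track S T v0 v4 q4" and q5: "track S T v4 v3 q5"
    and k1: "track S T v1 w k1" and k2: "track S T v2 w k2" and k3: "track S T v3 w k3" and k4: "track S T v4 w k4"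
    and 1: "track_eq S T v0 w (join_track q1 k1) k0" and 2: "track_eq S T v1 w (join_track q2 k2) k1" and 3: "track_eq S T v2 w (join_track q3 k3) k2"
    and 4: "track_eq S T v0 w (join_track q4 k4) k0" and 5: "track_eq S T v4 w (join_track q5 k3) k4"
  shows "track_eq S T v0 v3 (join_track q1 (join_track q2 q3)) (join_track q4 q5)"
proof (rule track_eq_right_cancel)
  have "track_eq S T v0 w (join_track (join_track q1 (join_track q2 q3)) k3) (join_track q1 (join_track (join_track q2 q3) k3))"
    by (rule track_eq_join_assoc[OF q1 track_join[OF q2 q3] k3])
  also have "track_eq S T v0 w \<dots> (join_track q1 (join_track q2 (join_track q3 k3)))"
    by (rule track_eq_join[OF _ track_eq_join_assoc[OF q2 q3 k3]]) (simp add: track_eq_refl q1)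
  also have "track_eq S T v0 w \<dots> (join_track q1 (join_track q2 k2))"
    by (rule track_eq_join[OF track_eq_refl[THEN iffD2, OF q1] track_eq_join[OF track_eq_refl[THEN iffD2, OF q2] 3]])
  also have "track_eq S T v0 w \<dots> (join_track q1 k1)"
    by (intro track_eq_join[OF _ 2]) (simp add: track_eq_refl q1)
  also note 1
  also have "track_eq S T v0 w k0 (join_track q4 k4)"
    by (rule track_eq_sym[OF 4])
  also have "track_eq S T v0 w \<dots> (join_track q4 (join_track q5 k3))"
    by (intro track_eq_join[OF _ track_eq_sym[OF 5]]) (simp add: track_eq_refl q4)
  also have "track_eq S T v0 w \<dots> (join_track (join_track q4 q5) k3)"
    by (rule track_eq_sym[OF track_eq_join_assoc[OF q4 q5 k3]])
  finally show "track_eq S T v0 w (join_track (join_track q1 (join_track q2 q3)) k3) (join_track (join_track q4 q5) k3)" .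
qed (fact k3 track_join[OF q1 track_join[OF q2 q3]] track_join[OF q4 q5])+

lemma continuous_map_mem: "continuous_map X Y f \<Longrightarrow> x \<in> topspace X \<Longrightarrow> f x \<in> topspace Y"
  by (auto simp: continuous_map_def)

lemma continuous_map_mem_prod:
  assumes "continuous_map X (prod_topology Y Z) f" "x \<in> topspace X"
  shows "fst (f x) \<in> topspace Y" "snd (f x) \<in> topspace Z"
  using continuous_map_mem[OF assms] by auto

text \<open>\<open>s1, s2\<close> and \<open>d1, d2, d3\<close> stand for the maps induced by the surjections from 3 to 2 and from 4 to 3;
  the one with index \<open>i\<close> identifies \<open>i - 1\<close> with \<open>i\<close>.\<close>
locale truncated_semigroup =
  fixes A :: "'a topology" and X2 :: "'b topology" and X3 :: "'c topology" and X4 :: "'d topology"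
    and a0 :: 'a and b2 :: 'b and b3 :: 'c and b4 :: 'd
    and xi11 :: "'b \<Rightarrow> 'a \<times> 'a" and xi12 :: "'c \<Rightarrow> 'a \<times> 'b" and xi21 :: "'c \<Rightarrow> 'b \<times> 'a"
    and xi13 :: "'d \<Rightarrow> 'a \<times> 'c" and xi22 :: "'d \<Rightarrow> 'b \<times> 'b" and xi31 :: "'d \<Rightarrow> 'c \<times> 'a"
    and mu :: "'b \<Rightarrow> 'a" and s1 s2 :: "'c \<Rightarrow> 'b" and d1 d2 d3 :: "'d \<Rightarrow> 'c"
    and g :: "'a \<times> 'a \<Rightarrow> 'b" and H :: "real \<times> 'b \<Rightarrow> 'b"
  assumes points: "a0 \<in> topspace A" "b2 \<in> topspace X2" "b3 \<in> topspace X3"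
    and heq11: "based_heq X2 b2 (prod_topology A A) (a0, a0) xi11"
    and heq12: "based_heq X3 b3 (prod_topology A X2) (a0, b2) xi12"
    and heq13: "based_heq X4 b4 (prod_topology A X3) (a0, b3) xi13"
    and g: "continuous_map (prod_topology A A) X2 g" "g (a0, a0) = b2"
    and H: "track X2 X2 (\<lambda>x. g (xi11 x)) (\<lambda>x. x) H" "\<forall>t\<in>{0..1}. H (t, b2) = b2"
    and cont: "continuous_map X2 (prod_topology A A) xi11" "continuous_map X3 (prod_topology A X2) xi12"
      "continuous_map X3 (prod_topology X2 A) xi21" "continuous_map X4 (prod_topology A X3) xi13"
      "continuous_map X4 (prod_topology X2 X2) xi22" "continuous_map X4 (prod_topology X3 A) xi31"
      "continuous_map X2 A mu" "continuous_map X3 X2 s1" "continuous_map X3 X2 s2"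
      "continuous_map X4 X3 d1" "continuous_map X4 X3 d2" "continuous_map X4 X3 d3"
    and based: "mu b2 = a0" "xi12 b3 = (a0, b2)" "xi21 b3 = (b2, a0)" "s1 b3 = b2" "s2 b3 = b2"
    and coassoc3: "x \<in> topspace X3 \<Longrightarrow> fst (xi11 (fst (xi21 x))) = fst (xi12 x)"
      "x \<in> topspace X3 \<Longrightarrow> snd (xi11 (fst (xi21 x))) = fst (xi11 (snd (xi12 x)))"
      "x \<in> topspace X3 \<Longrightarrow> snd (xi11 (snd (xi12 x))) = snd (xi21 x)"
    and coassoc4: "z \<in> topspace X4 \<Longrightarrow> fst (xi11 (fst (xi22 z))) = fst (xi13 z)"
      "z \<in> topspace X4 \<Longrightarrow> snd (xi11 (fst (xi22 z))) = fst (xi12 (snd (xi13 z)))"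
      "z \<in> topspace X4 \<Longrightarrow> snd (xi12 (snd (xi13 z))) = snd (xi22 z)"
      "z \<in> topspace X4 \<Longrightarrow> fst (xi12 (fst (xi31 z))) = fst (xi13 z)"
      "z \<in> topspace X4 \<Longrightarrow> snd (xi12 (fst (xi31 z))) = fst (xi21 (snd (xi13 z)))"
      "z \<in> topspace X4 \<Longrightarrow> snd (xi21 (snd (xi13 z))) = snd (xi31 z)"
      "z \<in> topspace X4 \<Longrightarrow> fst (xi21 (fst (xi31 z))) = fst (xi22 z)"
      "z \<in> topspace X4 \<Longrightarrow> snd (xi21 (fst (xi31 z))) = fst (xi11 (snd (xi22 z)))"
      "z \<in> topspace X4 \<Longrightarrow> snd (xi11 (snd (xi22 z))) = snd (xi31 z)"
    and natural3: "x \<in> topspace X3 \<Longrightarrow> xi11 (s1 x) = (mu (fst (xi21 x)), snd (xi21 x))"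
      "x \<in> topspace X3 \<Longrightarrow> xi11 (s2 x) = (fst (xi12 x), mu (snd (xi12 x)))"
    and natural4: "z \<in> topspace X4 \<Longrightarrow> xi21 (d1 z) = (s1 (fst (xi31 z)), snd (xi31 z))"
      "z \<in> topspace X4 \<Longrightarrow> xi12 (d1 z) = (mu (fst (xi22 z)), snd (xi22 z))"
      "z \<in> topspace X4 \<Longrightarrow> xi21 (d2 z) = (s2 (fst (xi31 z)), snd (xi31 z))"
      "z \<in> topspace X4 \<Longrightarrow> xi12 (d2 z) = (fst (xi13 z), s1 (snd (xi13 z)))"
      "z \<in> topspace X4 \<Longrightarrow> xi21 (d3 z) = (fst (xi22 z), mu (snd (xi22 z)))"
      "z \<in> topspace X4 \<Longrightarrow> xi12 (d3 z) = (fst (xi13 z), s2 (snd (xi13 z)))"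
    and mu_assoc: "x \<in> topspace X3 \<Longrightarrow> mu (s2 x) = mu (s1 x)"
    and simplicial: "z \<in> topspace X4 \<Longrightarrow> s1 (d2 z) = s1 (d1 z)"
      "z \<in> topspace X4 \<Longrightarrow> s2 (d2 z) = s2 (d3 z)"
      "z \<in> topspace X4 \<Longrightarrow> s1 (d3 z) = s2 (d1 z)"
begin

section \<open>Product, bracketings over X 3, and the associativity homotopy\<close>

definition "m2 p = mu (g p)"
definition "eta z = mu (H z)"
definition "lassoc p = m2 (m2 (fst p, fst (snd p)), snd (snd p))"
definition "rassoc p = m2 (fst p, m2 (snd p))"
text \<open>The first coordinate is split off repeatedly, so \<open>xi3\<close> and
  \<open>xi4\<close> are equivalences by composition and
  \<open>based_heq_prod_right\<close>.\<close>

definition "xi3 x = (fst (xi12 x), xi11 (snd (xi12 x)))"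
definition "xi4 z = (fst (xi13 z), xi3 (snd (xi13 z)))"
definition "tau x = mu (s1 x)"
text \<open>\<open>l1\<close> contracts the inner product of the left bracketing and
  \<open>l2\<close> the outer one; by naturality they meet at \<open>m2 (xi11 (s1 x))\<close>.
  \<open>r1\<close> and \<open>r2\<close> do the same for the right bracketing through
  \<open>s2\<close>, and \<open>mu_assoc\<close> makes both routes end at
  \<open>tau\<close>.\<close>

definition "l1 z = m2 (eta (fst z, fst (xi21 (snd z))), snd (xi21 (snd z)))"
definition "l2 z = eta (fst z, s1 (snd z))"
definition "r1 z = m2 (fst (xi12 (snd z)), eta (fst z, snd (xi12 (snd z))))"
definition "r2 z = eta (fst z, s2 (snd z))"

lemma m2_continuous: "continuous_map (prod_topology A A) A m2"
  unfolding m2_def[abs_def] by (rule continuous_map_apply[OF cont(7) g(1)])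

lemma eta_track: "track X2 A (\<lambda>x. m2 (xi11 x)) mu eta"
  unfolding m2_def eta_def[abs_def] by (rule track_postcompose[OF H(1) cont(7)])

lemma eta_based: "t \<in> {0..1} \<Longrightarrow> eta (t, b2) = a0"
  by (simp add: eta_def H(2) based)

lemma m2_based: "m2 (a0, a0) = a0"
  by (simp add: m2_def g based)

lemmas capply = cont[THEN continuous_map_apply] m2_continuous[THEN continuous_map_apply]
  eta_track[THEN trackD(1), THEN continuous_map_apply] continuous_map_fst_apply continuous_map_snd_apply
  continuous_map_pairedI continuous_map_id[unfolded id_def]

lemmas mem = cont(1-6)[THEN continuous_map_mem_prod(1)] cont(1-6)[THEN continuous_map_mem_prod(2)]
  cont(7-12)[THEN continuous_map_mem]

lemmas eta_ends = trackD(2,3)[OF eta_track]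

text \<open>\<open>xi3\<close> is built from \<open>xi12\<close>, which suits the right bracketing.
  Coassociativity passes to \<open>xi21\<close>, where \<open>eta\<close> applies to the inner
  product ab.\<close>

lemma lassoc_xi3: "x \<in> topspace X3 \<Longrightarrow> lassoc (xi3 x) = m2 (m2 (xi11 (fst (xi21 x))), snd (xi21 x))"
  using coassoc3[of x] by (simp add: lassoc_def xi3_def flip: coassoc3(1,2))

lemma rassoc_xi3: "rassoc (xi3 x) = m2 (fst (xi12 x), m2 (xi11 (snd (xi12 x))))"
  by (simp add: rassoc_def xi3_def)

lemma l1_track: "track X3 A (\<lambda>x. lassoc (xi3 x)) (\<lambda>x. m2 (xi11 (s1 x))) l1"
proof -
  have "continuous_map (prod_topology unit_interval X3) A l1"
    unfolding l1_def[abs_def] by (rule capply)+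
  then show ?thesis
    by (simp add: track_def l1_def lassoc_xi3 eta_ends mem natural3)
qed

lemma l2_track: "track X3 A (\<lambda>x. m2 (xi11 (s1 x))) tau l2"
  unfolding l2_def[abs_def] tau_def[abs_def] by (rule track_precompose[OF eta_track cont(8)])

lemma r1_track: "track X3 A (\<lambda>x. rassoc (xi3 x)) (\<lambda>x. m2 (xi11 (s2 x))) r1"
proof -
  have "continuous_map (prod_topology unit_interval X3) A r1"
    unfolding r1_def[abs_def] by (rule capply)+
  then show ?thesis
    by (simp add: track_def r1_def rassoc_xi3 eta_ends mem natural3)
qed

lemma r2_track: "track X3 A (\<lambda>x. m2 (xi11 (s2 x))) tau r2"
  by (rule track_cong[OF track_precompose[OF eta_track cont(9), folded r2_def]]) (simp_all add: tau_def mu_assoc)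

lemma xi3_heq: "based_heq X3 b3 (prod_topology A (prod_topology A A)) (a0, a0, a0) xi3"
  using based_heq_compose[OF heq12 based_heq_prod_right[OF heq11 points(1)]]
  by (simp add: xi3_def[abs_def] o_def)

lemma xi4_heq: "based_heq X4 b4 (prod_topology A (prod_topology A (prod_topology A A))) (a0, a0, a0, a0) xi4"
  using based_heq_compose[OF heq13 based_heq_prod_right[OF xi3_heq points(1)]]
  by (simp add: xi4_def[abs_def] o_def)

lemma assoc_continuous:
  "continuous_map (prod_topology A (prod_topology A A)) A lassoc"
  "continuous_map (prod_topology A (prod_topology A A)) A rassoc"
  unfolding lassoc_def[abs_def] rassoc_def[abs_def] by (rule capply)+

text \<open>The last conclusion is the working characterisation of \<open>m3\<close>: over X 3 it
  translates the route of the right bracketing to \<open>tau\<close> into that of the left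
  one.\<close>

lemma associator:
  obtains m3 where "track (prod_topology A (prod_topology A A)) A lassoc rassoc m3"
    and "\<And>t. t \<in> {0..1} \<Longrightarrow> m3 (t, a0, a0, a0) = a0"
    and "track_eq X3 A (\<lambda>x. lassoc (xi3 x)) tau (join_track (\<lambda>z. m3 (fst z, xi3 (snd z))) (join_track r1 r2)) (join_track l1 l2)"
proof -
  have L: "track X3 A (\<lambda>x. lassoc (xi3 x)) tau (join_track l1 l2)"
    by (rule track_join[OF l1_track l2_track])
  have R: "track X3 A (\<lambda>x. rassoc (xi3 x)) tau (join_track r1 r2)"
    by (rule track_join[OF r1_track r2_track])
  let ?a = "join_track (join_track l1 l2) (rev_track (join_track r1 r2))"
  have a: "track X3 A (\<lambda>x. lassoc (xi3 x)) (\<lambda>x. rassoc (xi3 x)) ?a"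
    by (rule track_join[OF L track_rev[OF R]])
  \<comment> \<open>All four pieces are constant at \<open>b3\<close>; this feeds the base point
    clause of \<open>track_descend\<close>.\<close>
  have a_based: "\<forall>t\<in>{0..1}. ?a (t, b3) = a0"
    by (auto simp: join_track_def rev_track_def l1_def l2_def r1_def r2_def based eta_based m2_based)
  obtain k J I where kJI: "continuous_map X3 (prod_topology A (prod_topology A A)) xi3"
    "continuous_map (prod_topology A (prod_topology A A)) X3 k" "k (a0, a0, a0) = b3"
    "track X3 X3 (\<lambda>x. k (xi3 x)) (\<lambda>x. x) I"
    "track (prod_topology A (prod_topology A A)) (prod_topology A (prod_topology A A)) (\<lambda>x. xi3 (k x)) (\<lambda>x. x) J"
    "\<forall>t\<in>{0..1}. J (t, a0, a0, a0) = (a0, a0, a0)"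
    using based_heqE[OF xi3_heq] by metis
  obtain m3 where m3: "track (prod_topology A (prod_topology A A)) A lassoc rassoc m3"
    and m3_xi3: "track_eq X3 A (\<lambda>x. lassoc (xi3 x)) (\<lambda>x. rassoc (xi3 x)) (\<lambda>z. m3 (fst z, xi3 (snd z))) ?a"
    and m3_based: "\<And>b0 e0 c t. \<lbrakk>\<forall>t\<in>{0..1}. J (t, b0) = b0; k b0 = e0; \<forall>t\<in>{0..1}. ?a (t, e0) = c; lassoc b0 = c;
      rassoc b0 = c; t \<in> {0..1}\<rbrakk> \<Longrightarrow> m3 (t, b0) = c"
    using track_descend[OF kJI(1,2,4,5) assoc_continuous a] by blast
  have "track_eq X3 A (\<lambda>x. lassoc (xi3 x)) tau (join_track (\<lambda>z. m3 (fst z, xi3 (snd z))) (join_track r1 r2)) (join_track ?a (join_track r1 r2))"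
    by (rule track_eq_join[OF m3_xi3]) (simp add: track_eq_refl R)
  also have "track_eq X3 A (\<lambda>x. lassoc (xi3 x)) tau \<dots> (join_track l1 l2)"
    using track_eq_cancel_right_rev[OF L track_rev[OF R]] by simp
  finally show thesis
    using that m3 m3_based[OF kJI(6,3) a_based] by (simp add: lassoc_def rassoc_def m2_based)
qed

text \<open>Each \<open>d i\<close> multiplies two adjacent coordinates by \<open>mu\<close>. These
  triples appear where \<open>eta\<close>, applied to such a pair inside \<open>m3\<close>, has
  reached its end.\<close>

lemma xi3_d:
  assumes "z \<in> topspace X4"
  shows "xi3 (d1 z) = (mu (fst (xi22 z)), xi11 (snd (xi22 z)))"
    and "xi3 (d2 z) = (fst (xi13 z), mu (fst (xi21 (snd (xi13 z)))), snd (xi31 z))"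
    and "xi3 (d3 z) = (fst (xi13 z), fst (xi12 (snd (xi13 z))), mu (snd (xi22 z)))"
  using assms mem by (simp_all add: xi3_def natural3 natural4 coassoc4)

text \<open>The five bracketings are coned off to the apex \<open>w\<close>. Over X 4 the products
  of adjacent factors are available as \<open>mu\<close> of structure maps, so every triangle of the
  cone comes from the relation for \<open>m3\<close> and from naturality.\<close>

lemma pentagon_over_X4:
  assumes m3: "track (prod_topology A (prod_topology A A)) A lassoc rassoc m3"
    and m3_xi3: "track_eq X3 A (\<lambda>x. lassoc (xi3 x)) tau (join_track (\<lambda>z. m3 (fst z, xi3 (snd z))) (join_track r1 r2)) (join_track l1 l2)"
  defines "q1 \<equiv> \<lambda>z. m2 (m3 (fst z, xi3 (fst (xi31 (snd z)))), snd (xi31 (snd z)))"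
    and "q2 \<equiv> \<lambda>z. m3 (fst z, fst (xi13 (snd z)), m2 (xi11 (fst (xi21 (snd (xi13 (snd z)))))), snd (xi31 (snd z)))"
    and "q3 \<equiv> \<lambda>z. m2 (fst (xi13 (snd z)), m3 (fst z, xi3 (snd (xi13 (snd z)))))"
    and "q4 \<equiv> \<lambda>z. m3 (fst z, m2 (xi11 (fst (xi22 (snd z)))), xi11 (snd (xi22 (snd z))))"
    and "q5 \<equiv> \<lambda>z. m3 (fst z, fst (xi11 (fst (xi22 (snd z)))), snd (xi11 (fst (xi22 (snd z)))), m2 (xi11 (snd (xi22 (snd z)))))"
    and "v0 \<equiv> \<lambda>z. m2 (lassoc (xi3 (fst (xi31 z))), snd (xi31 z))"
    and "v3 \<equiv> \<lambda>z. m2 (fst (xi13 z), rassoc (xi3 (snd (xi13 z))))"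
  shows "track_eq X4 A v0 v3 (join_track q1 (join_track q2 q3)) (join_track q4 q5)"
proof -
  note m3_apply = continuous_map_apply[OF trackD(1)[OF m3]]
  note xi3_cont = based_heq_def[THEN iffD1, OF xi3_heq, THEN conjunct1, unfolded based_map_def, THEN conjunct1]
  note xi3_apply = continuous_map_apply[OF xi3_cont]
  have m3_ends: "m3 (0, p) = lassoc p" "m3 (1, p) = rassoc p" if "p \<in> topspace A \<times> topspace A \<times> topspace A" for p
    using trackD(2,3)[OF m3] that by auto
  have xi3_mem: "xi3 x \<in> topspace A \<times> topspace A \<times> topspace A" if "x \<in> topspace X3" for x
    using continuous_map_mem[OF xi3_cont that] by simp
  have eta_mem: "eta (t, x) \<in> topspace A" if "0 \<le> t" "t \<le> 1" "x \<in> topspace X2" for t x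
    using continuous_map_mem[OF trackD(1)[OF eta_track], of "(t, x)"] that by simp
  have m2_mem: "m2 p \<in> topspace A" if "p \<in> topspace A \<times> topspace A" for p
    using continuous_map_mem[OF m2_continuous, of p] that by simp
  have xi11_mem: "xi11 x \<in> topspace A \<times> topspace A" if "x \<in> topspace X2" for x
    using continuous_map_mem[OF cont(1) that] by simp

  have xi11_xi22: "xi11 (fst (xi22 z)) = (fst (xi13 z), fst (xi12 (snd (xi13 z))))" if "z \<in> topspace X4" for z
    using coassoc4(1,2)[OF that] by (simp add: prod_eq_iff)

  define w where "w = (\<lambda>z. tau (d1 z))"
  define v1 where "v1 = (\<lambda>z. m2 (rassoc (xi3 (fst (xi31 z))), snd (xi31 z)))"
  define v2 where "v2 = (\<lambda>z. m2 (fst (xi13 z), lassoc (xi3 (snd (xi13 z)))))"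
  define v4 where "v4 = (\<lambda>z. m2 (m2 (xi11 (fst (xi22 z))), m2 (xi11 (snd (xi22 z)))))"
  define ll where "ll = (\<lambda>z. m2 (tau (fst (xi31 z)), snd (xi31 z)))"
  define rr where "rr = (\<lambda>z. m2 (fst (xi13 z), tau (snd (xi13 z))))"
  define mm where "mm = (\<lambda>z. m2 (mu (fst (xi22 z)), mu (snd (xi22 z))))"
  \<comment> \<open>The last leg to \<open>w\<close> is \<open>eta\<close> at a point of X 2. The
    composites stand for the surjections from 4 to 2 with fibre sizes 3 + 1, 1 + 3 and 2 +
    2.\<close>
  define el where "el = (\<lambda>z. eta (fst z, s1 (d1 (snd z))))"
  define er where "er = (\<lambda>z. eta (fst z, s2 (d3 (snd z))))"
  define em where "em = (\<lambda>z. eta (fst z, s2 (d1 (snd z))))"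
  note v_defs = v0_def v1_def v2_def v3_def v4_def ll_def rr_def mm_def w_def

  have el: "track X4 A ll w el"
    unfolding el_def by (rule track_cong[OF track_precompose[OF track_precompose[OF eta_track cont(8)] cont(10), simplified]])
      (simp_all add: v_defs tau_def mem natural3 natural4)
  have er: "track X4 A rr w er"
    unfolding er_def by (rule track_cong[OF track_precompose[OF track_precompose[OF eta_track cont(9)] cont(12), simplified]])
      (simp_all add: v_defs tau_def mem natural3 natural4 mu_assoc simplicial)
  have em: "track X4 A mm w em"
    unfolding em_def by (rule track_cong[OF track_precompose[OF track_precompose[OF eta_track cont(9)] cont(10), simplified]])
      (simp_all add: v_defs tau_def mem natural3 natural4 mu_assoc)

  \<comment> \<open>Tracks on X 3 multiplied by the last coordinate d on the right, or by the first
    coordinate a on the left.\<close>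
  let ?left = "\<lambda>p z. m2 (p (fst z, fst (xi31 (snd z))), snd (xi31 (snd z)))"
  let ?right = "\<lambda>p z. m2 (fst (xi13 (snd z)), p (fst z, snd (xi13 (snd z))))"
  have left_eq: "track_eq X4 A (\<lambda>z. m2 (u (fst (xi31 z)), snd (xi31 z))) (\<lambda>z. m2 (v (fst (xi31 z)), snd (xi31 z))) (?left p) (?left q)"
    if "track_eq X3 A u v p q" for u v p q
  proof -
    have "continuous_map X4 X3 (\<lambda>z. fst (xi31 z))"
      by (rule capply)+
    moreover have "continuous_map (prod_topology A X4) A (\<lambda>y. m2 (fst y, snd (xi31 (snd y))))"
      by (rule capply)+
    ultimately show ?thesis
      using track_eq_whisker[OF that] by fastforce
  qed
  have right_eq: "track_eq X4 A (\<lambda>z. m2 (fst (xi13 z), u (snd (xi13 z)))) (\<lambda>z. m2 (fst (xi13 z), v (snd (xi13 z)))) (?right p) (?right q)"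
    if "track_eq X3 A u v p q" for u v p q
  proof -
    have "continuous_map X4 X3 (\<lambda>z. snd (xi13 z))"
      by (rule capply)+
    moreover have "continuous_map (prod_topology A X4) A (\<lambda>y. m2 (fst (xi13 (snd y)), fst y))"
      by (rule capply)+
    ultimately show ?thesis
      using track_eq_whisker[OF that] by fastforce
  qed
  note left = left_eq[of _ _ p p for p, unfolded track_eq_refl]
  note right = right_eq[of _ _ p p for p, unfolded track_eq_refl]
  have join_left: "?left (join_track p q) = join_track (?left p) (?left q)" and join_right: "?right (join_track p q) = join_track (?right p) (?right q)" for p q
    by (auto simp: join_track_def fun_eq_iff)

  define y0 where "y0 = (\<lambda>z. m2 (m2 (xi11 (s1 (fst (xi31 z)))), snd (xi31 z)))"
  define y1 where "y1 = (\<lambda>z. m2 (m2 (xi11 (s2 (fst (xi31 z)))), snd (xi31 z)))"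
  define y2 where "y2 = (\<lambda>z. m2 (fst (xi13 z), m2 (xi11 (s1 (snd (xi13 z))))))"
  define y3 where "y3 = (\<lambda>z. m2 (fst (xi13 z), m2 (xi11 (s2 (snd (xi13 z))))))"
  have la: "track X4 A v0 y0 (?left l1)" "track X4 A y0 ll (?left l2)"
    "track X4 A v1 y1 (?left r1)" "track X4 A y1 ll (?left r2)"
    using left[OF l1_track] left[OF l2_track] left[OF r1_track] left[OF r2_track]
    by (simp_all add: v_defs y0_def y1_def)
  have ra: "track X4 A v2 y2 (?right l1)" "track X4 A y2 rr (?right l2)"
    "track X4 A v3 y3 (?right r1)" "track X4 A y3 rr (?right r2)"
    using right[OF l1_track] right[OF l2_track] right[OF r1_track] right[OF r2_track]
    by (simp_all add: v_defs y2_def y3_def)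

  \<comment> \<open>\<open>k0\<close> and \<open>k1\<close> contract abc first and pass through
    \<open>ll\<close>; \<open>k2\<close> and \<open>k3\<close> contract bcd first and pass through
    \<open>rr\<close>.\<close>
  define k0 where "k0 = join_track (join_track (?left l1) (?left l2)) el"
  define k1 where "k1 = join_track (join_track (?left r1) (?left r2)) el"
  define k2 where "k2 = join_track (join_track (?right l1) (?right l2)) er"
  define k3 where "k3 = join_track (join_track (?right r1) (?right r2)) er"
  have k1: "track X4 A v1 w k1" and k2: "track X4 A v2 w k2" and k3: "track X4 A v3 w k3"
    unfolding k1_def k2_def k3_def by (rule track_join[OF track_join el] track_join[OF track_join er], fact, fact)+

  have m3x: "track X3 A (\<lambda>x. lassoc (xi3 x)) (\<lambda>x. rassoc (xi3 x)) (\<lambda>z. m3 (fst z, xi3 (snd z)))"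
    by (rule track_precompose[OF m3 xi3_cont])
  have q1: "track X4 A v0 v1 q1"
    using left[OF m3x] by (simp add: q1_def v_defs)
  have q3: "track X4 A v2 v3 q3"
    using right[OF m3x] by (simp add: q3_def v_defs)
  have cont_q: "continuous_map (prod_topology unit_interval X4) A q2"
    "continuous_map (prod_topology unit_interval X4) A q4"
    "continuous_map (prod_topology unit_interval X4) A q5"
    unfolding q2_def q4_def q5_def by (rule m3_apply capply)+
  have q2: "track X4 A v1 v2 q2"
    using cont_q(1)
    by (auto simp: track_def q2_def v_defs m3_ends mem m2_mem xi11_mem lassoc_xi3 rassoc_xi3 coassoc4 lassoc_def[of "(_, _)"] rassoc_def[of "(_, _)"])
  have q4: "track X4 A v0 v4 q4"
    using cont_q(2)
    by (auto simp: track_def q4_def v_defs m3_ends mem m2_mem xi11_mem lassoc_xi3 rassoc_xi3 coassoc4 lassoc_def[of "(_, _)"] rassoc_def[of "(_, _)"])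
  have q5: "track X4 A v4 v3 q5"
    using cont_q(3)
    by (auto simp: xi11_xi22 track_def q5_def v_defs m3_ends mem m2_mem xi11_mem lassoc_xi3 rassoc_xi3 coassoc4 lassoc_def[of "(_, _)"] rassoc_def[of "(_, _)"])

  \<comment> \<open>Edges 1 and 3 are \<open>m3\<close> multiplied by d or by a, so their triangles
    are the relation for \<open>m3\<close>, multiplied likewise and extended by the last
    leg.\<close>
  have 1: "track_eq X4 A v0 w (join_track q1 k1) k0"
  proof -
    have "track_eq X4 A v0 w (join_track q1 k1) (join_track (join_track q1 (join_track (?left r1) (?left r2))) el)"
      unfolding k1_def by (rule track_eq_sym[OF track_eq_join_assoc[OF q1 track_join[OF la(3,4)] el]])
    also have "track_eq X4 A v0 w \<dots> k0"
      unfolding k0_def using left_eq[OF m3_xi3]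
      by (intro track_eq_join[OF _ track_eq_refl[THEN iffD2, OF el]]) (simp add: join_left v_defs q1_def)
    finally show ?thesis .
  qed
  have 3: "track_eq X4 A v2 w (join_track q3 k3) k2"
  proof -
    have "track_eq X4 A v2 w (join_track q3 k3) (join_track (join_track q3 (join_track (?right r1) (?right r2))) er)"
      unfolding k3_def by (rule track_eq_sym[OF track_eq_join_assoc[OF q3 track_join[OF ra(3,4)] er]])
    also have "track_eq X4 A v2 w \<dots> k2"
      unfolding k2_def using right_eq[OF m3_xi3]
      by (intro track_eq_join[OF _ track_eq_refl[THEN iffD2, OF er]]) (simp add: join_right v_defs q3_def)
    finally show ?thesis .
  qed

  \<comment> \<open>The two orders of contracting the pairs in (ab)(cd): \<open>n1\<close> and
    \<open>n2\<close> begin with ab, \<open>n3\<close> and \<open>n4\<close> with cd. Edge 4 meets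
    the first order and edge 5 the second.\<close>
  define n1 where "n1 = (\<lambda>z. m2 (eta (fst z, fst (xi22 (snd z))), m2 (xi11 (snd (xi22 (snd z))))))"
  define n2 where "n2 = (\<lambda>z. m2 (mu (fst (xi22 (snd z))), eta (fst z, snd (xi22 (snd z)))))"
  define n3 where "n3 = (\<lambda>z. m2 (m2 (xi11 (fst (xi22 (snd z)))), eta (fst z, snd (xi22 (snd z)))))"
  define n4 where "n4 = (\<lambda>z. m2 (eta (fst z, fst (xi22 (snd z))), mu (snd (xi22 (snd z)))))"
  define y4 where "y4 = (\<lambda>z. m2 (mu (fst (xi22 z)), m2 (xi11 (snd (xi22 z)))))"
  define y5 where "y5 = (\<lambda>z. m2 (m2 (xi11 (fst (xi22 z))), mu (snd (xi22 z))))"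
  have cont_n: "continuous_map (prod_topology unit_interval X4) A n1"
    "continuous_map (prod_topology unit_interval X4) A n2"
    "continuous_map (prod_topology unit_interval X4) A n3"
    "continuous_map (prod_topology unit_interval X4) A n4"
    unfolding n1_def n2_def n3_def n4_def by (rule capply)+
  have n: "track X4 A v4 y4 n1" "track X4 A y4 mm n2" "track X4 A v4 y5 n3" "track X4 A y5 mm n4"
    using cont_n by (auto simp: track_def n1_def n2_def n3_def n4_def v_defs y4_def y5_def eta_ends mem)
  define k4 where "k4 = join_track (join_track n1 n2) em"
  have k4: "track X4 A v4 w k4"
    unfolding k4_def by (rule track_join[OF track_join[OF n(1,2)] em])
  \<comment> \<open>The contractions of ab and cd have independent parameters, and the square they
    span exchanges the order.\<close>
  have swap: "track_eq X4 A v4 w (join_track (join_track n3 n4) em) k4"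
    unfolding k4_def
  proof (rule track_eq_join[OF _ track_eq_refl[THEN iffD2, OF em]])
    let ?F = "\<lambda>z. m2 (eta (fst (snd z), fst (xi22 (snd (snd z)))), eta (fst z, snd (xi22 (snd (snd z)))))"
    have F: "continuous_map (prod_topology unit_interval (prod_topology unit_interval X4)) A ?F"
      by (rule capply)+
    show "track_eq X4 A v4 mm (join_track n3 n4) (join_track n1 n2)"
      by (rule track_eq_square[OF F]) (simp_all add: n1_def n2_def n3_def n4_def v_defs eta_ends mem)
  qed

  let ?s = "\<lambda>d z. m3 (fst z, xi3 (d (snd z)))"
  have join_pre: "(\<lambda>z. join_track p q (fst z, d (snd z))) = join_track (\<lambda>z. p (fst z, d (snd z))) (\<lambda>z. q (fst z, d (snd z)))"
    for p q :: "real \<times> 'c \<Rightarrow> 'a" and d :: "'d \<Rightarrow> 'c"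
    by (simp add: join_track_def fun_eq_iff)
  have hex: "track_eq X4 A (\<lambda>z. lassoc (xi3 (d z))) (\<lambda>z. tau (d z))
      (join_track (?s d) (join_track (\<lambda>z. r1 (fst z, d (snd z))) (\<lambda>z. r2 (fst z, d (snd z)))))
      (join_track (\<lambda>z. l1 (fst z, d (snd z))) (\<lambda>z. l2 (fst z, d (snd z))))"
    if "continuous_map X4 X3 d" for d
    using track_eq_precompose[OF m3_xi3 that] by (simp add: join_pre)
  have s1: "track X4 A y0 y4 (?s d1)"
    by (rule track_cong[OF track_precompose[OF m3x cont(10), simplified]])
      (simp_all add: xi11_xi22 y0_def y1_def y2_def y3_def y4_def y5_def lassoc_xi3 rassoc_xi3 mem natural4)
  have s2: "track X4 A y1 y2 (?s d2)"
    by (rule track_cong[OF track_precompose[OF m3x cont(11), simplified]])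
      (simp_all add: xi11_xi22 y0_def y1_def y2_def y3_def y4_def y5_def lassoc_xi3 rassoc_xi3 mem natural4)
  have s3: "track X4 A y5 y3 (?s d3)"
    by (rule track_cong[OF track_precompose[OF m3x cont(12), simplified]])
      (simp_all add: xi11_xi22 y0_def y1_def y2_def y3_def y4_def y5_def lassoc_xi3 rassoc_xi3 mem natural4)

  \<comment> \<open>Edges 2, 4 and 5 have a product, namely bc, ab or cd, as an argument of
    \<open>m3\<close>. Contracting it by \<open>eta\<close> gives a naturality square, whose far
    side is \<open>m3\<close> at \<open>d2\<close>, \<open>d1\<close> or \<open>d3\<close>.\<close>
  have 2: "track_eq X4 A v1 w (join_track q2 k2) k1"
    unfolding k1_def k2_def
  proof (rule track_eq_prism[OF q2 la(3,4) ra(1,2) el er s2])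
    let ?F = "\<lambda>z. m3 (fst z, fst (xi13 (snd (snd z))),
      eta (fst (snd z), fst (xi21 (snd (xi13 (snd (snd z)))))), snd (xi31 (snd (snd z))))"
    have F: "continuous_map (prod_topology unit_interval (prod_topology unit_interval X4)) A ?F"
      by (rule m3_apply capply)+
    show "track_eq X4 A v1 y2 (join_track q2 (?right l1)) (join_track (?left r1) (?s d2))"
      by (rule track_eq_square[OF F])
        (simp_all add: q2_def l1_def r1_def v_defs y2_def eta_ends m3_ends mem eta_mem m2_mem xi11_mem coassoc4 xi3_d natural3
          rassoc_xi3 lassoc_def[of "(_, _)"] rassoc_def[of "(_, _)"])
    \<comment> \<open>By \<open>natural4\<close> and \<open>simplicial\<close> the four tracks
      besides \<open>?s d2\<close> are \<open>r1\<close>, \<open>r2\<close>, \<open>l1\<close> and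
      \<open>l2\<close> evaluated at \<open>d2\<close>, so this is an instance of
      \<open>hex\<close>.\<close>
    show "track_eq X4 A y1 w (join_track (?s d2) (join_track (?right l2) er)) (join_track (?left r2) el)"
      by (rule track_eq_cong[OF hex[OF cont(11)]])
        (simp_all add: join_track_def l1_def l2_def r1_def r2_def el_def er_def y1_def w_def tau_def lassoc_xi3 natural4 mem simplicial)
  qed
  have 4: "track_eq X4 A v0 w (join_track q4 k4) k0"
    unfolding k0_def k4_def
  proof (rule track_eq_prism[OF q4 la(1,2) n(1,2) el em s1])
    let ?F = "\<lambda>z. m3 (fst z, eta (fst (snd z), fst (xi22 (snd (snd z)))), xi11 (snd (xi22 (snd (snd z)))))"
    have F: "continuous_map (prod_topology unit_interval (prod_topology unit_interval X4)) A ?F"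
      by (rule m3_apply capply)+
    show "track_eq X4 A v0 y4 (join_track q4 n1) (join_track (?left l1) (?s d1))"
      by (rule track_eq_square[OF F])
        (simp_all add: q4_def l1_def n1_def v_defs y4_def eta_ends m3_ends mem eta_mem m2_mem xi11_mem coassoc4 xi3_d
          lassoc_xi3 lassoc_def[of "(_, _)"] rassoc_def[of "(_, _)"])
    show "track_eq X4 A y0 w (join_track (?s d1) (join_track n2 em)) (join_track (?left l2) el)"
      by (rule track_eq_cong[OF hex[OF cont(10)]])
        (simp_all add: join_track_def l1_def l2_def r1_def r2_def el_def em_def n2_def y0_def w_def tau_def lassoc_xi3 natural4 mem simplicial)
  qed
  have "track_eq X4 A v4 w (join_track q5 k3) (join_track (join_track n3 n4) em)"
    unfolding k3_def
  proof (rule track_eq_prism[OF q5 n(3,4) ra(3,4) em er s3])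
    let ?F = "\<lambda>z. m3 (fst z, fst (xi11 (fst (xi22 (snd (snd z))))), snd (xi11 (fst (xi22 (snd (snd z))))),
      eta (fst (snd z), snd (xi22 (snd (snd z)))))"
    have F: "continuous_map (prod_topology unit_interval (prod_topology unit_interval X4)) A ?F"
      by (rule m3_apply capply)+
    show "track_eq X4 A v4 y3 (join_track q5 (?right r1)) (join_track n3 (?s d3))"
      by (rule track_eq_square[OF F])
        (simp_all add: xi11_xi22 q5_def r1_def n3_def v_defs y3_def eta_ends m3_ends mem eta_mem m2_mem xi11_mem coassoc4 xi3_d natural3
          rassoc_xi3 lassoc_def[of "(_, _)"] rassoc_def[of "(_, _)"])
    show "track_eq X4 A y5 w (join_track (?s d3) (join_track (?right r2) er)) (join_track n4 em)"
      by (rule track_eq_cong[OF hex[OF cont(12)]])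
        (simp_all add: join_track_def l1_def l2_def r1_def r2_def er_def em_def n4_def y5_def w_def tau_def lassoc_xi3 natural4 mem simplicial mu_assoc)
  qed
  then have 5: "track_eq X4 A v4 w (join_track q5 k3) k4"
    using swap track_eq_trans by blast
  show ?thesis
    by (rule track_eq_pentagon_cone[OF q1 q2 q3 q4 q5 k1 k2 k3 k4 1 2 3 4 5])
qed

lemma A4_space_exists: "\<exists>m3 m4. A4_space A a0 m2 m3 m4"
proof -
  obtain m3 where m3: "track (prod_topology A (prod_topology A A)) A lassoc rassoc m3"
    and m3_based: "\<And>t. t \<in> {0..1} \<Longrightarrow> m3 (t, a0, a0, a0) = a0"
    and m3_xi3: "track_eq X3 A (\<lambda>x. lassoc (xi3 x)) tau (join_track (\<lambda>z. m3 (fst z, xi3 (snd z))) (join_track r1 r2)) (join_track l1 l2)"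
    by (rule associator) (rule that, blast+)
  let ?A4 = "prod_topology A (prod_topology A (prod_topology A A))"
  note m3_apply = continuous_map_apply[OF trackD(1)[OF m3]]
  have m3_ends: "m3 (0, a, b, c) = m2 (m2 (a, b), c)" "m3 (1, a, b, c) = m2 (a, m2 (b, c))"
    if "a \<in> topspace A" "b \<in> topspace A" "c \<in> topspace A" for a b c
    using trackD(2,3)[OF m3, of "(a, b, c)"] that by (simp_all add: lassoc_def rassoc_def)
  have m2_mem: "m2 (a, b) \<in> topspace A" if "a \<in> topspace A" "b \<in> topspace A" for a b
    using continuous_map_mem[OF m2_continuous, of "(a, b)"] that by simp
  define e1 where "e1 = (\<lambda>(t, a, b, c, d). m2 (m3 (t, a, b, c), d))"
  define e2 where "e2 = (\<lambda>(t, a, b, c, d). m3 (t, a, m2 (b, c), d))"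
  define e3 where "e3 = (\<lambda>(t, a, b, c, d). m2 (a, m3 (t, b, c, d)))"
  define e4 where "e4 = (\<lambda>(t, a, b, c, d). m3 (t, m2 (a, b), c, d))"
  define e5 where "e5 = (\<lambda>(t, a, b, c, d). m3 (t, a, b, m2 (c, d)))"
  define v0 where "v0 = (\<lambda>(a, b, c, d). m2 (m2 (m2 (a, b), c), d))"
  define v1 where "v1 = (\<lambda>(a, b, c, d). m2 (m2 (a, m2 (b, c)), d))"
  define v2 where "v2 = (\<lambda>(a, b, c, d). m2 (a, m2 (m2 (b, c), d)))"
  define v3 where "v3 = (\<lambda>(a, b, c, d). m2 (a, m2 (b, m2 (c, d))))"
  define v4 where "v4 = (\<lambda>(a, b, c, d). m2 (m2 (a, b), m2 (c, d)))"
  note defs = e1_def e2_def e3_def e4_def e5_def v0_def v1_def v2_def v3_def v4_def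
  have cont_e: "continuous_map (prod_topology unit_interval ?A4) A e1"
    "continuous_map (prod_topology unit_interval ?A4) A e2"
    "continuous_map (prod_topology unit_interval ?A4) A e3"
    "continuous_map (prod_topology unit_interval ?A4) A e4"
    "continuous_map (prod_topology unit_interval ?A4) A e5"
    unfolding defs case_prod_unfold by (rule m3_apply capply)+
  have e: "track ?A4 A v0 v1 e1" "track ?A4 A v1 v2 e2" "track ?A4 A v2 v3 e3" "track ?A4 A v0 v4 e4" "track ?A4 A v4 v3 e5"
    using cont_e by (simp_all add: track_def defs m3_ends m2_mem case_prod_unfold mem_Times_iff)

  \<comment> \<open>The same coordinate of a point of X 4 can be reached through several structure
    maps; coassociativity brings all of them to one normal form.\<close>
  have xi3_fst31: "xi3 (fst (xi31 z)) = (fst (xi13 z), fst (xi12 (snd (xi13 z))), fst (xi11 (snd (xi22 z))))"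
    and xi3_snd13: "xi3 (snd (xi13 z)) = (fst (xi12 (snd (xi13 z))), xi11 (snd (xi22 z)))"
    and xi4: "xi4 z = (fst (xi13 z), fst (xi12 (snd (xi13 z))), fst (xi11 (snd (xi22 z))), snd (xi31 z))"
    and xi11s: "xi11 (fst (xi22 z)) = (fst (xi13 z), fst (xi12 (snd (xi13 z))))"
      "xi11 (fst (xi21 (snd (xi13 z)))) = (fst (xi12 (snd (xi13 z))), fst (xi11 (snd (xi22 z))))"
      "(fst (xi11 (snd (xi22 z))), snd (xi31 z)) = xi11 (snd (xi22 z))"
    if "z \<in> topspace X4" for z
    using that coassoc3[of "snd (xi13 z)"] by (simp_all add: xi3_def xi4_def coassoc4 mem prod_eq_iff)
  obtain h I J where "continuous_map ?A4 X4 h" "track ?A4 ?A4 (\<lambda>x. xi4 (h x)) (\<lambda>x. x) J"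
    using based_heqE[OF xi4_heq] by metis
  \<comment> \<open>Substituting \<open>xi4 z\<close> for (a, b, c, d) turns the edges over the
    fourfold product into those treated over X 4. The right homotopy inverse \<open>h\<close> of
    \<open>xi4\<close> then allows \<open>xi4\<close> to be dropped.\<close>
  moreover have "track_eq X4 A (\<lambda>z. v0 (xi4 z)) (\<lambda>z. v3 (xi4 z))
      (\<lambda>z. join_track e1 (join_track e2 e3) (fst z, xi4 (snd z))) (\<lambda>z. join_track e4 e5 (fst z, xi4 (snd z)))"
    by (rule track_eq_cong[OF pentagon_over_X4[OF m3 m3_xi3]])
      (simp_all add: join_track_def defs case_prod_unfold coassoc4(9) xi4 lassoc_def rassoc_def xi11s xi3_fst31 xi3_snd13)
  ultimately have "track_eq ?A4 A v0 v3 (join_track e1 (join_track e2 e3)) (join_track e4 e5)"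
    using track_eq_precompose_inject[OF _ _ track_join[OF e(1) track_join[OF e(2,3)]] track_join[OF e(4,5)]] by blast
  then obtain m4 where m4: "continuous_map (prod_topology K4 ?A4) A m4"
    and m4_edges: "\<And>t x. t \<in> {0..1} \<Longrightarrow> x \<in> topspace ?A4 \<Longrightarrow>
      m4 (seg P0 P1 t, x) = e1 (t, x) \<and> m4 (seg P1 P2 t, x) = e2 (t, x) \<and> m4 (seg P2 P3 t, x) = e3 (t, x) \<and>
      m4 (seg P0 P4 t, x) = e4 (t, x) \<and> m4 (seg P4 P3 t, x) = e5 (t, x)"
    using pentagon_fill[OF e] by metis
  have "A4_space A a0 m2 m3 m4"
    unfolding A4_space_def
    using points(1) m2_continuous m2_based trackD(1)[OF m3] m3_ends m3_based m4 m4_edges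
    by (simp add: K3_def defs)
  then show ?thesis
    by blast
qed

end

subsection \<open>Homotopy semigroups\<close>

lemma surj_mor_terminal: "0 < n \<Longrightarrow> restrict (\<lambda>_. 0) {0..<n} \<in> surj_mor n 1"
  by (auto simp: surj_mor_def mono_on_def image_iff)

lemma id_mor_surj_mor: "id_mor n \<in> surj_mor n n"
  by (auto simp: surj_mor_def id_mor_def mono_on_def)

lemma osum_mor_surj_mor:
  assumes "f \<in> surj_mor m m'" "g \<in> surj_mor n n'"
  shows "osum_mor m n m' f g \<in> surj_mor (m + n) (m' + n')"
proof -
  have f: "f i < m'" if "i < m" for i
    using assms(1) that by (auto simp: surj_mor_def)
  have g: "g i < n'" if "i < n" for i
    using assms(2) that by (auto simp: surj_mor_def)
  have "osum_mor m n m' f g i \<le> osum_mor m n m' f g j" if "i \<le> j" "j < m + n" for i j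
  proof -
    have "f i \<le> f j" if "j < m"
      using assms(1) \<open>i \<le> j\<close> that by (auto simp: surj_mor_def mono_on_def)
    moreover have "g (i - m) \<le> g (j - m)" if "m \<le> i"
    proof -
      have "i - m \<le> j - m" "j - m < n"
        using that \<open>i \<le> j\<close> \<open>j < m + n\<close> by auto
      then show ?thesis
        using assms(2) by (auto simp: surj_mor_def mono_on_def)
    qed
    \<comment> \<open>The case where \<open>i\<close> and \<open>j\<close> lie in different
      summands: values of \<open>f\<close> stay below \<open>m'\<close>, and shifted values of
      \<open>g\<close> start there.\<close>
    moreover have "f i \<le> m' + k" if "i < m" for k
      using f[OF that] by simp
    ultimately show ?thesis
      using that by (auto simp: osum_mor_def)
  qed
  moreover have "osum_mor m n m' f g ` {0..<m + n} = {0..<m' + n'}"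
  proof (intro equalityI subsetI)
    fix k assume k: "k \<in> {0..<m' + n'}"
    show "k \<in> osum_mor m n m' f g ` {0..<m + n}"
    proof (cases "k < m'")
      case True
      then have "k \<in> f ` {0..<m}"
        using assms(1) by (auto simp: surj_mor_def)
      then obtain i where "i < m" "k = f i"
        by auto
      then show ?thesis
        by (intro image_eqI[of _ _ i]) (auto simp: osum_mor_def)
    next
      case False
      then have "k - m' \<in> g ` {0..<n}"
        using assms(2) k by (auto simp: surj_mor_def)
      then obtain i where "i < n" "k - m' = g i"
        by auto
      then show ?thesis
        using False by (intro image_eqI[of _ _ "m + i"]) (auto simp: osum_mor_def)
    qed
  next
    fix k assume "k \<in> osum_mor m n m' f g ` {0..<m + n}"
    then obtain i where "i < m + n" "k = osum_mor m n m' f g i"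
      by auto
    then show "k \<in> {0..<m' + n'}"
      using f[of i] g[of "i - m"] by (cases "i < m") (auto simp: osum_mor_def)
  qed
  moreover have "osum_mor m n m' f g \<in> extensional {0..<m + n}"
    by (simp add: osum_mor_def)
  ultimately show ?thesis
    by (auto simp: surj_mor_def mono_on_def PiE_iff)
qed

theorem theorem3p4p1:
  fixes X :: "nat \<Rightarrow> 'a topology" and b :: "nat \<Rightarrow> 'a"
    and Xm :: "nat \<Rightarrow> nat \<Rightarrow> (nat \<Rightarrow> nat) \<Rightarrow> 'a \<Rightarrow> 'a"
    and \<xi> :: "nat \<Rightarrow> nat \<Rightarrow> 'a \<Rightarrow> 'a \<times> 'a"
  assumes "homotopy_semigroup X b Xm \<xi>"
  shows "\<exists>g m2 m3 m4.
           based_homotopy_inverse (X 2) (b 2) (prod_topology (X 1) (X 1)) (b 1, b 1) (\<xi> 1 1) g \<and>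
           (\<forall>p\<in>topspace (prod_topology (X 1) (X 1)).
              m2 p = Xm 2 1 (restrict (\<lambda>_. 0) {0..<2}) (g p)) \<and>
           A4_space (X 1) (b 1) m2 m3 m4"
proof -
  have points: "b n \<in> topspace (X n)" for n
    using assms by (simp add: homotopy_semigroup_def)
  have mor: "based_map (X n) (b n) (X m) (b m) (Xm n m f)" if "f \<in> surj_mor n m" for n m f
    using assms that by (simp add: homotopy_semigroup_def)
  have mor_id: "Xm n n (id_mor n) x = x" if "x \<in> topspace (X n)" for n x
    using assms that by (simp add: homotopy_semigroup_def)
  have mor_comp: "Xm m k g (Xm n m f x) = Xm n k (comp_mor n g f) x"
    if "f \<in> surj_mor n m" "g \<in> surj_mor m k" "x \<in> topspace (X n)" for n m k f g x
    using assms that unfolding homotopy_semigroup_def by metis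
  have xi: "based_map (X (m + n)) (b (m + n)) (prod_topology (X m) (X n)) (b m, b n) (\<xi> m n)" for m n
    using assms by (simp add: homotopy_semigroup_def)
  have natural: "\<xi> m' n' (Xm (m + n) (m' + n') (osum_mor m n m' f g) x) = (Xm m m' f (fst (\<xi> m n x)), Xm n n' g (snd (\<xi> m n x)))"
    if "f \<in> surj_mor m m'" "g \<in> surj_mor n n'" "x \<in> topspace (X (m + n))" for m n m' n' f g x
    using assms that unfolding homotopy_semigroup_def by metis
  have coassoc: "fst (\<xi> l m (fst (\<xi> (l + m) n x))) = fst (\<xi> l (m + n) x)"
      "snd (\<xi> l m (fst (\<xi> (l + m) n x))) = fst (\<xi> m n (snd (\<xi> l (m + n) x)))"
      "snd (\<xi> (l + m) n x) = snd (\<xi> m n (snd (\<xi> l (m + n) x)))"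
    if "x \<in> topspace (X (l + m + n))" for l m n x
    using assms that unfolding homotopy_semigroup_def by (metis prod.inject)+
  have heq: "based_heq (X (m + n)) (b (m + n)) (prod_topology (X m) (X n)) (b m, b n) (\<xi> m n)" for m n
    using assms by (simp add: homotopy_semigroup_def)

  \<comment> \<open>Instances at numerals mention \<open>X (1 + 1)\<close> and the like; unfolding
    these sums yields \<open>X 2\<close>, \<open>X 3\<close> and \<open>X 4\<close>.\<close>
  have nums: "1 + 1 = (2::nat)" "1 + 2 = (3::nat)" "2 + 1 = (3::nat)" "1 + 3 = (4::nat)" "2 + 2 = (4::nat)" "3 + 1 = (4::nat)"
    by simp_all
  note xi11 = xi[of 1 1, unfolded nums] and xi12 = xi[of 1 2, unfolded nums] and xi21 = xi[of 2 1, unfolded nums]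
    and xi13 = xi[of 1 3, unfolded nums] and xi22 = xi[of 2 2, unfolded nums] and xi31 = xi[of 3 1, unfolded nums]
  note xis = xi11 xi12 xi21 xi13 xi22 xi31
  note xis_cont = xis[unfolded based_map_def, THEN conjunct1]
  note mem = xis_cont[THEN continuous_map_mem_prod(1)] xis_cont[THEN continuous_map_mem_prod(2)]

  define S where "S = restrict (\<lambda>_. 0::nat) {0..<2::nat}"
  define f1 where "f1 = osum_mor 2 1 1 S (id_mor 1)"
  define f2 where "f2 = osum_mor 1 2 1 (id_mor 1) S"
  define h1 where "h1 = osum_mor 3 1 2 f1 (id_mor 1)"
  define h2 where "h2 = osum_mor 3 1 2 f2 (id_mor 1)"
  define h3 where "h3 = osum_mor 1 3 1 (id_mor 1) f2"
  note mor_defs = h1_def h2_def h3_def f1_def f2_def S_def osum_mor_def id_mor_def comp_mor_def compose_def restrict_def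
  \<comment> \<open>Each surjection from 4 to 3 splits as an ordinal sum in a second way, so
    naturality applies to it at both \<open>\<xi> 2 1\<close> and \<open>\<xi> 1 2\<close>.\<close>
  have h1': "h1 = osum_mor 2 2 1 S (id_mor 2)" and h2': "h2 = osum_mor 1 3 1 (id_mor 1) f1" and h3': "h3 = osum_mor 2 2 2 (id_mor 2) S"
    by (auto simp: mor_defs fun_eq_iff)
  have comps: "comp_mor 3 S f2 = comp_mor 3 S f1" "comp_mor 4 f1 h2 = comp_mor 4 f1 h1"
    "comp_mor 4 f2 h2 = comp_mor 4 f2 h3" "comp_mor 4 f1 h3 = comp_mor 4 f2 h1"
    by (auto simp: mor_defs fun_eq_iff)
  have S: "S \<in> surj_mor 2 1"
    unfolding S_def by (rule surj_mor_terminal) simp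
  have f: "f1 \<in> surj_mor 3 2" "f2 \<in> surj_mor 3 2"
    using osum_mor_surj_mor[OF S id_mor_surj_mor, of 1] osum_mor_surj_mor[OF id_mor_surj_mor S, of 1]
    unfolding f1_def f2_def nums by auto
  have h: "h1 \<in> surj_mor 4 3" "h2 \<in> surj_mor 4 3" "h3 \<in> surj_mor 4 3"
    using osum_mor_surj_mor[OF f(1) id_mor_surj_mor, of 1] osum_mor_surj_mor[OF f(2) id_mor_surj_mor, of 1]
      osum_mor_surj_mor[OF id_mor_surj_mor f(2), of 1]
    unfolding h1_def h2_def h3_def nums by auto
  define mu where "mu = Xm 2 1 S"
  define s1 where "s1 = Xm 3 2 f1"
  define s2 where "s2 = Xm 3 2 f2"
  define d1 where "d1 = Xm 4 3 h1"
  define d2 where "d2 = Xm 4 3 h2"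
  define d3 where "d3 = Xm 4 3 h3"
  note maps = mor[OF S, folded mu_def] mor[OF f(1), folded s1_def] mor[OF f(2), folded s2_def]
    mor[OF h(1), folded d1_def] mor[OF h(2), folded d2_def] mor[OF h(3), folded d3_def]
  obtain g H J where g_inv: "based_homotopy_inverse (X 2) (b 2) (prod_topology (X 1) (X 1)) (b 1, b 1) (\<xi> 1 1) g"
    "continuous_map (prod_topology (X 1) (X 1)) (X 2) g" "g (b 1, b 1) = b 2"
    "track (X 2) (X 2) (\<lambda>x. g (\<xi> 1 1 x)) (\<lambda>x. x) H" "\<forall>t\<in>{0..1}. H (t, b 2) = b 2"
    by (rule based_heqE[OF heq[of 1 1, unfolded nums]])
  have natural3: "\<xi> 1 1 (s1 x) = (mu (fst (\<xi> 2 1 x)), snd (\<xi> 2 1 x))"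
    "\<xi> 1 1 (s2 x) = (fst (\<xi> 1 2 x), mu (snd (\<xi> 1 2 x)))" if "x \<in> topspace (X 3)" for x
    using natural[OF S id_mor_surj_mor, of x 1, unfolded nums] natural[OF id_mor_surj_mor S, of x 1, unfolded nums] that mem
    by (simp_all add: s1_def s2_def f1_def f2_def mu_def mor_id del: One_nat_def)
  have natural4: "\<xi> 2 1 (d1 z) = (s1 (fst (\<xi> 3 1 z)), snd (\<xi> 3 1 z))"
    "\<xi> 1 2 (d1 z) = (mu (fst (\<xi> 2 2 z)), snd (\<xi> 2 2 z))"
    "\<xi> 2 1 (d2 z) = (s2 (fst (\<xi> 3 1 z)), snd (\<xi> 3 1 z))"
    "\<xi> 1 2 (d2 z) = (fst (\<xi> 1 3 z), s1 (snd (\<xi> 1 3 z)))"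
    "\<xi> 2 1 (d3 z) = (fst (\<xi> 2 2 z), mu (snd (\<xi> 2 2 z)))"
    "\<xi> 1 2 (d3 z) = (fst (\<xi> 1 3 z), s2 (snd (\<xi> 1 3 z)))" if "z \<in> topspace (X 4)" for z
    using natural[OF f(1) id_mor_surj_mor, of z 1, unfolded nums, folded h1_def d1_def s1_def]
      natural[OF S id_mor_surj_mor, of z 2, unfolded nums, folded h1' d1_def mu_def]
      natural[OF f(2) id_mor_surj_mor, of z 1, unfolded nums, folded h2_def d2_def s2_def]
      natural[OF id_mor_surj_mor f(1), of z 1, unfolded nums, folded h2' d2_def s1_def]
      natural[OF id_mor_surj_mor S, of z 2, unfolded nums, folded h3' d3_def mu_def]
      natural[OF id_mor_surj_mor f(2), of z 1, unfolded nums, folded h3_def d3_def s2_def] that mem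
    by (simp_all add: mor_id del: One_nat_def)
  have simplicial: "x \<in> topspace (X 3) \<Longrightarrow> mu (s2 x) = mu (s1 x)"
    "z \<in> topspace (X 4) \<Longrightarrow> s1 (d2 z) = s1 (d1 z)"
    "z \<in> topspace (X 4) \<Longrightarrow> s2 (d2 z) = s2 (d3 z)"
    "z \<in> topspace (X 4) \<Longrightarrow> s1 (d3 z) = s2 (d1 z)" for x z
    unfolding mu_def s1_def s2_def d1_def d2_def d3_def by (simp_all add: mor_comp S f h comps del: One_nat_def)
  interpret truncated_semigroup "X 1" "X 2" "X 3" "X 4" "b 1" "b 2" "b 3" "b 4"
    "\<xi> 1 1" "\<xi> 1 2" "\<xi> 2 1" "\<xi> 1 3" "\<xi> 2 2" "\<xi> 3 1" mu s1 s2 d1 d2 d3 g H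
  proof (unfold_locales)
    show "based_heq (X 2) (b 2) (prod_topology (X 1) (X 1)) (b 1, b 1) (\<xi> 1 1)"
      by (rule heq[of 1 1, unfolded nums])
    show "based_heq (X 3) (b 3) (prod_topology (X 1) (X 2)) (b 1, b 2) (\<xi> 1 2)"
      by (rule heq[of 1 2, unfolded nums])
    show "based_heq (X 4) (b 4) (prod_topology (X 1) (X 3)) (b 1, b 3) (\<xi> 1 3)"
      by (rule heq[of 1 3, unfolded nums])
  \<comment> \<open>The splitting 1 + 1 + 1 gives \<open>coassoc3\<close>; the splittings 1 + 1 + 2,
    1 + 2 + 1 and 2 + 1 + 1 give the nine equations of \<open>coassoc4\<close>, three each.\<close>
  qed ((fact points g_inv simplicial natural3 natural4 | use xis maps in \<open>simp add: based_map_def; fail\<close>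
        | use coassoc[of _ 1 1 1, unfolded nums] coassoc[of _ 1 1 2, unfolded nums] coassoc[of _ 1 2 1, unfolded nums]
          coassoc[of _ 2 1 1, unfolded nums] in \<open>simp; fail\<close>)+)
  have "\<exists>m3 m4. A4_space (X 1) (b 1) m2 m3 m4"
    by (rule A4_space_exists)
  moreover have "m2 p = Xm 2 1 (restrict (\<lambda>_. 0) {0..<2}) (g p)" for p
    by (simp only: m2_def mu_def[symmetric] S_def[symmetric])
  ultimately show ?thesis
    using g_inv(1) by blast
qed

end
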